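(* There is a closed well-formed RGA term $u$ such that $\emptyset\vdash u\cdot\underline n$ is derivable in RGA for every $n\in\mathbb N$, while $\mathcal A\cdot u$ evaluates to true at no step index, i.e. there is no $s\in\mathbb N$ with $\mathcal A\cdot u\Downarrow_s\mathsf{tt}$.
   Context: **Terms.** Raw terms are: variables $v_i$ ($i\in\mathbb N$, de Bruijn indices), and operator nodes, each consisting of an operator code, a binder count $k\in\mathbb N$ and a finite list of raw terms as arguments, in each of which the $k$ lowest indices are bound. RGA has ten operators: constants $\bot$, $\mathbf 0$, $\mathcal R$ (recursor), $\mathcal A$ (universal quantifier combinator); unary $\mathbf S$, $\neg$; unary $\lambda$ (binder count 1, the only binder); binary $=$, $\lor$, and application $\cdot$ (left associative). A term $t$ is well-formed, $\mathrm{wf}(t)$, iff it is built from variables and these ten operators at these arities and binder counts. "Term" means raw term; formulas are just terms. Closed means having no free variables. $\underline n=\mathbf S^n\mathbf 0$ is the numeral of $n$. $[v_i\mapsto s]t$ (also $[i\mapsto s]t$): capture-avoiding replacement of the free variable $v_i$ by $s$, other free variables unchanged. $b[t]$: $\beta$-instance, replacing index $0$ in $b$ by $t$ and decrementing all other free indices. $\uparrow t$: all free indices increased by one; $\uparrow\Gamma$ elementwise. $\mathrm{fv}$: set of free variables. Abbreviations: $t\neq u:=\neg(t=u)$; $t\,\mathsf N:=(t=t)$; $t\,\mathsf B:=(t\lor\neg t)$; $t\land u:=\neg(\neg t\lor\neg u)$. **Head steps** $t\triangleright t'$ (syntactic relation): $(\lambda b)\cdot t\triangleright b[t]$ if $\mathrm{wf}(t)$;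 $\mathcal R\cdot g\cdot h\cdot\mathbf 0\triangleright g$ if $\mathrm{wf}(h)$; $\mathcal R\cdot g\cdot h\cdot(\mathbf S\,\underline n)\triangleright h\cdot\underline n\cdot(\mathcal R\cdot g\cdot h\cdot\underline n)$ if $\mathrm{wf}(g)$; and $t\cdot u\triangleright t'\cdot u$ if $t\triangleright t'$. **Proofs.** A judgment $\Gamma\vdash c$ has a finite set $\Gamma$ of terms and a term $c$. A proof is a finite list of judgments each following from earlier entries by one rule below; $P\rhd(\Gamma\vdash c)$ means $P$ is a valid proof containing $\Gamma\vdash c$; a judgment is derivable if some proof contains it. Writing $\Gamma\vdash c$ as an assertion means derivability. Rules ($\Rightarrow$ from premises to conclusion, $\Leftrightarrow$ both directions): Structural: $\mathrm{wf}(c)\Rightarrow\Gamma,c\vdash c$; $\Gamma\vdash c\Rightarrow\Gamma,a\vdash c$; $\Gamma\vdash a$ and $\Gamma,a\vdash c\Rightarrow\Gamma\vdash c$; $\Gamma\vdash c$ with $\Gamma,c,s$ well-formed $\Rightarrow[v\mapsto s]\Gamma\vdash[v\mapsto s]c$. Truth values: $\Gamma\vdash a\Leftrightarrow\Gamma\vdash a=\underline 1$; $\Gamma\vdash\neg a\Leftrightarrow\Gamma\vdash a=\underline 0$. Negation: $\Gamma\vdash\neg a$, $\Gamma\vdash a$, $\mathrm{wf}(c)\Rightarrow\Gamma\vdash c$; $\Gamma\vdash a\Leftrightarrow\Gamma\vdash\neg\neg a$. Disjunction: $\Gamma\vdash a$, $\mathrm{wf}(b)\Rightarrow\Gamma\vdash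 a\lor b$; $\Gamma\vdash b$, $\mathrm{wf}(a)\Rightarrow\Gamma\vdash a\lor b$; $\Gamma\vdash\neg a$, $\Gamma\vdash\neg b\Rightarrow\Gamma\vdash\neg(a\lor b)$; $\Gamma\vdash a\lor b$, $\Gamma,a\vdash c$, $\Gamma,b\vdash c\Rightarrow\Gamma\vdash c$; $\Gamma\vdash\neg(a\lor b)\Rightarrow\Gamma\vdash\neg a$, and $\Rightarrow\Gamma\vdash\neg b$. Equality: $\Gamma\vdash a\,\mathsf N\Leftrightarrow\Gamma\vdash a=a$; $\Gamma\vdash a=b\Rightarrow\Gamma\vdash b=a$; $\Gamma\vdash a=b$, $\Gamma\vdash[v\mapsto a]p$, $\mathrm{wf}(p)\Rightarrow\Gamma\vdash[v\mapsto b]p$; $\Gamma\vdash a\ne b\Rightarrow\Gamma\vdash b\ne a$; $\Gamma\vdash a\,\mathsf N$, $\Gamma\vdash b\,\mathsf N\Rightarrow\Gamma\vdash(a=b)\,\mathsf B$; $\Gamma\vdash(a=b)\,\mathsf B\Rightarrow\Gamma\vdash(a\,\mathsf N)\land(b\,\mathsf N)$. Naturals: $\Gamma\vdash\mathbf 0\,\mathsf N$; $\Gamma\vdash a\,\mathsf N\Leftrightarrow\Gamma\vdash\mathbf S a\,\mathsf N$; $\Gamma\vdash a\,\mathsf N\Rightarrow\Gamma\vdash\mathbf S a\ne\mathbf 0$; $\Gamma\vdash a\ne b\Leftrightarrow\Gamma\vdash\mathbf S a\ne\mathbf S b$; $\Gamma\vdash\mathbf S a=\mathbf S b\Rightarrow\Gamma\vdash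 a=b$; $\Gamma\vdash\bot\,\mathsf N$, $\mathrm{wf}(p)\Rightarrow\Gamma\vdash p$. Induction: $\Gamma\vdash[i\mapsto\mathbf 0]c$; $v_i\,\mathsf N,c,\Gamma\vdash[i\mapsto\mathbf S v_i]c$; $\Gamma\vdash a\,\mathsf N$; $\mathrm{wf}(c)$; $i\notin\mathrm{fv}(\Gamma)$ $\Rightarrow\Gamma\vdash[i\mapsto a]c$. Conversion: if $c\triangleright c'$: $\Gamma\vdash c'\Leftrightarrow\Gamma\vdash c$; $\Gamma\vdash c'\,\mathsf N\Rightarrow\Gamma\vdash c=c'$. Recursor: $\Gamma\vdash m\,\mathsf N$, $\Gamma\vdash(h\cdot m\cdot(\mathcal R\cdot g\cdot h\cdot m))\,\mathsf N$, $\mathrm{wf}(g)\Rightarrow\Gamma\vdash\mathcal R\cdot g\cdot h\cdot(\mathbf S m)=h\cdot m\cdot(\mathcal R\cdot g\cdot h\cdot m)$. Quantifier: $v_0\,\mathsf N,\uparrow\Gamma\vdash\uparrow f\cdot v_0\Rightarrow\Gamma\vdash\mathcal A\cdot f$; $\Gamma\vdash\mathcal A\cdot f$, $\Gamma\vdash a\,\mathsf N\Rightarrow\Gamma\vdash f\cdot a$; $\Gamma\vdash\neg(f\cdot a)$, $\Gamma\vdash a\,\mathsf N\Rightarrow\Gamma\vdash\neg(\mathcal A\cdot f)$; $\Gamma\vdash\neg(\mathcal A\cdot f)$ and $v_0\,\mathsf N,\neg(\uparrow f\cdot v_0),\uparrow\Gamma\vdash\uparrow c\Rightarrow\Gamma\vdash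 c$. **Evaluation.** Fix a standard effective injective Gödel coding $P\mapsto\ulcorner P\urcorner\in\mathbb N$ of proofs. Let $\mathsf{tt}=1$, $\mathsf{ff}=0$. Head shapes $w$ are: $\lambda b$; $\mathcal R$; $\mathcal R\,g$; $\mathcal R\,g\,h$; $\mathcal A$. Value evaluation $t\Downarrow_s r$ ($r,s\in\mathbb N$) and head evaluation $t\Downarrow^{\mathrm{hd}}_s w$ are the least relations on (possibly open) terms such that for all $s$ (there are no clauses for $\bot$ or variables): Values: $\mathbf 0\Downarrow_{s+1}0$; $a\Downarrow_s n\Rightarrow\mathbf S a\Downarrow_{s+1}n+1$; $a\Downarrow_s m$, $b\Downarrow_s n\Rightarrow(a=b)\Downarrow_{s+1}\mathsf{tt}$ if $m=n$ and $\mathsf{ff}$ otherwise; $a\Downarrow_s\mathsf{ff}\Rightarrow\neg a\Downarrow_{s+1}\mathsf{tt}$; $a\Downarrow_s\mathsf{tt}\Rightarrow\neg a\Downarrow_{s+1}\mathsf{ff}$; $a\Downarrow_s\mathsf{tt}$ or $b\Downarrow_s\mathsf{tt}\Rightarrow(a\lor b)\Downarrow_{s+1}\mathsf{tt}$; $a\Downarrow_s\mathsf{ff}$ and $b\Downarrow_s\mathsf{ff}\Rightarrow(a\lor b)\Downarrow_{s+1}\mathsf{ff}$; $t\Downarrow^{\mathrm{hd}}_s\lambda b$, $b[u]\Downarrow_s r\Rightarrow t\cdot u\Downarrow_{s+1}r$; $t\Downarrow^{\mathrm{hd}}_s\mathcal R\,g\,h$, $m\Downarrow_s 0$, $g\Downarrow_s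 r\Rightarrow t\cdot m\Downarrow_{s+1}r$; $t\Downarrow^{\mathrm{hd}}_s\mathcal R\,g\,h$, $m\Downarrow_s k+1$, $h\cdot\underline k\cdot(\mathcal R\cdot g\cdot h\cdot\underline k)\Downarrow_s r\Rightarrow t\cdot m\Downarrow_{s+1}r$. Quantifier: if $t\Downarrow^{\mathrm{hd}}_s\mathcal A$ and $\ulcorner P\urcorner\le s$, then $P\rhd(\{v_0\,\mathsf N\}\vdash\uparrow u\cdot v_0)\Rightarrow t\cdot u\Downarrow_{s+1}\mathsf{tt}$, and $P\rhd(\emptyset\vdash\neg(u\cdot\underline i))$ for some $i\in\mathbb N$ $\Rightarrow t\cdot u\Downarrow_{s+1}\mathsf{ff}$. Heads: $\lambda b\Downarrow^{\mathrm{hd}}_{s+1}\lambda b$; $\mathcal R\Downarrow^{\mathrm{hd}}_{s+1}\mathcal R$; $\mathcal A\Downarrow^{\mathrm{hd}}_{s+1}\mathcal A$; $t\Downarrow^{\mathrm{hd}}_s\mathcal R\Rightarrow t\cdot g\Downarrow^{\mathrm{hd}}_{s+1}\mathcal R\,g$; $t\Downarrow^{\mathrm{hd}}_s\mathcal R\,g\Rightarrow t\cdot h\Downarrow^{\mathrm{hd}}_{s+1}\mathcal R\,g\,h$; and the three clauses for $t\cdot u$, $t\cdot m$ above (heads $\lambda b$ and $\mathcal R\,g\,h$) with the last premise and the conclusion replaced by head evaluation to the same $w$. *)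

theory Defs
  imports Main "HOL-Library.FSet" "HOL-Library.Nat_Bijection"
begin

section \<open>Raw terms\<close>

text \<open>\<open>Op f k ts\<close> is a node with operator code \<open>f\<close> whose \<open>k\<close> lowest indices are bound in
  each argument. Operator codes are arbitrary naturals; RGA uses the codes 0 to 9.\<close>

datatype rterm = Var nat | Op nat nat "rterm list"

abbreviation Bot :: rterm where "Bot \<equiv> Op 0 0 []"
abbreviation Zero :: rterm where "Zero \<equiv> Op 1 0 []"
abbreviation Rec :: rterm where "Rec \<equiv> Op 2 0 []"
abbreviation AllC :: rterm where "AllC \<equiv> Op 3 0 []"
abbreviation Succ :: "rterm \<Rightarrow> rterm" where "Succ t \<equiv> Op 4 0 [t]"
abbreviation Neg :: "rterm \<Rightarrow> rterm" ("\<^bold>\<not> _" [85] 85) where "\<^bold>\<not> t \<equiv> Op 5 0 [t]"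
abbreviation Lam :: "rterm \<Rightarrow> rterm" where "Lam b \<equiv> Op 6 1 [b]"
abbreviation Eq :: "rterm \<Rightarrow> rterm \<Rightarrow> rterm" (infix "\<^bold>=" 70) where "t \<^bold>= u \<equiv> Op 7 0 [t, u]"
abbreviation Or :: "rterm \<Rightarrow> rterm \<Rightarrow> rterm" (infixr "\<^bold>\<or>" 60) where "t \<^bold>\<or> u \<equiv> Op 8 0 [t, u]"
abbreviation App :: "rterm \<Rightarrow> rterm \<Rightarrow> rterm" (infixl "\<^bold>\<cdot>" 90) where "t \<^bold>\<cdot> u \<equiv> Op 9 0 [t, u]"

abbreviation Neq :: "rterm \<Rightarrow> rterm \<Rightarrow> rterm" (infix "\<^bold>\<noteq>" 70) where "t \<^bold>\<noteq> u \<equiv> \<^bold>\<not> (t \<^bold>= u)"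
abbreviation isN :: "rterm \<Rightarrow> rterm" where "isN t \<equiv> (t \<^bold>= t)"
abbreviation isB :: "rterm \<Rightarrow> rterm" where "isB t \<equiv> (t \<^bold>\<or> \<^bold>\<not> t)"
abbreviation And :: "rterm \<Rightarrow> rterm \<Rightarrow> rterm" (infixr "\<^bold>\<and>" 65) where "t \<^bold>\<and> u \<equiv> \<^bold>\<not> (\<^bold>\<not> t \<^bold>\<or> \<^bold>\<not> u)"

primrec num :: "nat \<Rightarrow> rterm" where
  "num 0 = Zero"
| "num (Suc n) = Succ (num n)"

inductive wf_term :: "rterm \<Rightarrow> bool" where
  "wf_term (Var i)"
| "wf_term Bot"
| "wf_term Zero"
| "wf_term Rec"
| "wf_term AllC"
| "wf_term t \<Longrightarrow> wf_term (Succ t)"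
| "wf_term t \<Longrightarrow> wf_term (\<^bold>\<not> t)"
| "wf_term b \<Longrightarrow> wf_term (Lam b)"
| "wf_term t \<Longrightarrow> wf_term u \<Longrightarrow> wf_term (t \<^bold>= u)"
| "wf_term t \<Longrightarrow> wf_term u \<Longrightarrow> wf_term (t \<^bold>\<or> u)"
| "wf_term t \<Longrightarrow> wf_term u \<Longrightarrow> wf_term (t \<^bold>\<cdot> u)"

fun fv :: "rterm \<Rightarrow> nat set" where
  "fv (Var i) = {i}"
| "fv (Op f k ts) = (\<Union>t\<in>set ts. {i. i + k \<in> fv t})"

definition closed_term :: "rterm \<Rightarrow> bool" where
  "closed_term t \<longleftrightarrow> fv t = {}"

fun lift_from :: "nat \<Rightarrow> rterm \<Rightarrow> rterm" where
  "lift_from c (Var i) = Var (if i < c then i else Suc i)"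
| "lift_from c (Op f k ts) = Op f k (map (lift_from (c + k)) ts)"

abbreviation lift :: "rterm \<Rightarrow> rterm" where "lift \<equiv> lift_from 0"

text \<open>\<open>subst i s t\<close> is \<open>[v\<^sub>i \<mapsto> s]t\<close>: unlike in \<open>inst\<close>, the other free indices are left unchanged.\<close>

fun subst :: "nat \<Rightarrow> rterm \<Rightarrow> rterm \<Rightarrow> rterm" where
  "subst i s (Var j) = (if j = i then s else Var j)"
| "subst i s (Op f k ts) = Op f k (map (subst (i + k) ((lift ^^ k) s)) ts)"

fun inst_at :: "nat \<Rightarrow> rterm \<Rightarrow> rterm \<Rightarrow> rterm" where
  "inst_at c s (Var j) = (if j < c then Var j else if j = c then s else Var (j - 1))"
| "inst_at c s (Op f k ts) = Op f k (map (inst_at (c + k) ((lift ^^ k) s)) ts)"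

text \<open>\<open>inst b t\<close> is the \<open>\<beta>\<close>-instance \<open>b[t]\<close>.\<close>

abbreviation inst :: "rterm \<Rightarrow> rterm \<Rightarrow> rterm" where "inst b t \<equiv> inst_at 0 t b"

inductive head_step :: "rterm \<Rightarrow> rterm \<Rightarrow> bool" (infix "\<triangleright>" 50) where
  beta: "wf_term t \<Longrightarrow> Lam b \<^bold>\<cdot> t \<triangleright> inst b t"
| rec_0: "wf_term h \<Longrightarrow> Rec \<^bold>\<cdot> g \<^bold>\<cdot> h \<^bold>\<cdot> Zero \<triangleright> g"
| rec_Suc: "wf_term g \<Longrightarrow>
    Rec \<^bold>\<cdot> g \<^bold>\<cdot> h \<^bold>\<cdot> Succ (num n) \<triangleright> h \<^bold>\<cdot> num n \<^bold>\<cdot> (Rec \<^bold>\<cdot> g \<^bold>\<cdot> h \<^bold>\<cdot> num n)"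
| app: "t \<triangleright> t' \<Longrightarrow> t \<^bold>\<cdot> u \<triangleright> t' \<^bold>\<cdot> u"


section \<open>Proofs\<close>

datatype sequent = Sequent "rterm fset" rterm (infix "\<turnstile>" 55)

text \<open>\<open>follows J j\<close>: the sequent \<open>j\<close> follows by one rule from premises in \<open>J\<close>.\<close>

inductive follows :: "sequent set \<Rightarrow> sequent \<Rightarrow> bool" for J :: "sequent set" where
  hyp: "wf_term c \<Longrightarrow> follows J (finsert c \<Gamma> \<turnstile> c)"
| weaken: "(\<Gamma> \<turnstile> c) \<in> J \<Longrightarrow> follows J (finsert a \<Gamma> \<turnstile> c)"
| cut: "(\<Gamma> \<turnstile> a) \<in> J \<Longrightarrow> (finsert a \<Gamma> \<turnstile> c) \<in> J \<Longrightarrow> follows J (\<Gamma> \<turnstile> c)"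
| substitution: "(\<Gamma> \<turnstile> c) \<in> J \<Longrightarrow> (\<And>x. x |\<in>| \<Gamma> \<Longrightarrow> wf_term x) \<Longrightarrow> wf_term c \<Longrightarrow> wf_term s \<Longrightarrow>
    follows J (subst v s |`| \<Gamma> \<turnstile> subst v s c)"

| true_I: "(\<Gamma> \<turnstile> a) \<in> J \<Longrightarrow> follows J (\<Gamma> \<turnstile> a \<^bold>= num 1)"
| true_E: "(\<Gamma> \<turnstile> a \<^bold>= num 1) \<in> J \<Longrightarrow> follows J (\<Gamma> \<turnstile> a)"
| false_I: "(\<Gamma> \<turnstile> \<^bold>\<not> a) \<in> J \<Longrightarrow> follows J (\<Gamma> \<turnstile> a \<^bold>= num 0)"
| false_E: "(\<Gamma> \<turnstile> a \<^bold>= num 0) \<in> J \<Longrightarrow> follows J (\<Gamma> \<turnstile> \<^bold>\<not> a)"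

| contradiction: "(\<Gamma> \<turnstile> \<^bold>\<not> a) \<in> J \<Longrightarrow> (\<Gamma> \<turnstile> a) \<in> J \<Longrightarrow> wf_term c \<Longrightarrow> follows J (\<Gamma> \<turnstile> c)"
| not_not_I: "(\<Gamma> \<turnstile> a) \<in> J \<Longrightarrow> follows J (\<Gamma> \<turnstile> \<^bold>\<not> \<^bold>\<not> a)"
| not_not_E: "(\<Gamma> \<turnstile> \<^bold>\<not> \<^bold>\<not> a) \<in> J \<Longrightarrow> follows J (\<Gamma> \<turnstile> a)"

| or_I1: "(\<Gamma> \<turnstile> a) \<in> J \<Longrightarrow> wf_term b \<Longrightarrow> follows J (\<Gamma> \<turnstile> a \<^bold>\<or> b)"
| or_I2: "(\<Gamma> \<turnstile> b) \<in> J \<Longrightarrow> wf_term a \<Longrightarrow> follows J (\<Gamma> \<turnstile> a \<^bold>\<or> b)"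
| not_or_I: "(\<Gamma> \<turnstile> \<^bold>\<not> a) \<in> J \<Longrightarrow> (\<Gamma> \<turnstile> \<^bold>\<not> b) \<in> J \<Longrightarrow> follows J (\<Gamma> \<turnstile> \<^bold>\<not> (a \<^bold>\<or> b))"
| or_E: "(\<Gamma> \<turnstile> a \<^bold>\<or> b) \<in> J \<Longrightarrow> (finsert a \<Gamma> \<turnstile> c) \<in> J \<Longrightarrow> (finsert b \<Gamma> \<turnstile> c) \<in> J \<Longrightarrow>
    follows J (\<Gamma> \<turnstile> c)"
| not_or_E1: "(\<Gamma> \<turnstile> \<^bold>\<not> (a \<^bold>\<or> b)) \<in> J \<Longrightarrow> follows J (\<Gamma> \<turnstile> \<^bold>\<not> a)"
| not_or_E2: "(\<Gamma> \<turnstile> \<^bold>\<not> (a \<^bold>\<or> b)) \<in> J \<Longrightarrow> follows J (\<Gamma> \<turnstile> \<^bold>\<not> b)"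

| isN_E: "(\<Gamma> \<turnstile> isN a) \<in> J \<Longrightarrow> follows J (\<Gamma> \<turnstile> a \<^bold>= a)"
| isN_I: "(\<Gamma> \<turnstile> a \<^bold>= a) \<in> J \<Longrightarrow> follows J (\<Gamma> \<turnstile> isN a)"
| eq_sym: "(\<Gamma> \<turnstile> a \<^bold>= b) \<in> J \<Longrightarrow> follows J (\<Gamma> \<turnstile> b \<^bold>= a)"
| eq_subst: "(\<Gamma> \<turnstile> a \<^bold>= b) \<in> J \<Longrightarrow> (\<Gamma> \<turnstile> subst v a p) \<in> J \<Longrightarrow> wf_term p \<Longrightarrow>
    follows J (\<Gamma> \<turnstile> subst v b p)"
| neq_sym: "(\<Gamma> \<turnstile> a \<^bold>\<noteq> b) \<in> J \<Longrightarrow> follows J (\<Gamma> \<turnstile> b \<^bold>\<noteq> a)"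
| eq_B_I: "(\<Gamma> \<turnstile> isN a) \<in> J \<Longrightarrow> (\<Gamma> \<turnstile> isN b) \<in> J \<Longrightarrow> follows J (\<Gamma> \<turnstile> isB (a \<^bold>= b))"
| eq_B_E: "(\<Gamma> \<turnstile> isB (a \<^bold>= b)) \<in> J \<Longrightarrow> follows J (\<Gamma> \<turnstile> isN a \<^bold>\<and> isN b)"

| zero_N: "follows J (\<Gamma> \<turnstile> isN Zero)"
| Succ_N_I: "(\<Gamma> \<turnstile> isN a) \<in> J \<Longrightarrow> follows J (\<Gamma> \<turnstile> isN (Succ a))"
| Succ_N_E: "(\<Gamma> \<turnstile> isN (Succ a)) \<in> J \<Longrightarrow> follows J (\<Gamma> \<turnstile> isN a)"
| Succ_neq_0: "(\<Gamma> \<turnstile> isN a) \<in> J \<Longrightarrow> follows J (\<Gamma> \<turnstile> Succ a \<^bold>\<noteq> Zero)"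
| Succ_neq_I: "(\<Gamma> \<turnstile> a \<^bold>\<noteq> b) \<in> J \<Longrightarrow> follows J (\<Gamma> \<turnstile> Succ a \<^bold>\<noteq> Succ b)"
| Succ_neq_E: "(\<Gamma> \<turnstile> Succ a \<^bold>\<noteq> Succ b) \<in> J \<Longrightarrow> follows J (\<Gamma> \<turnstile> a \<^bold>\<noteq> b)"
| Succ_eq_E: "(\<Gamma> \<turnstile> Succ a \<^bold>= Succ b) \<in> J \<Longrightarrow> follows J (\<Gamma> \<turnstile> a \<^bold>= b)"
| Bot_N_E: "(\<Gamma> \<turnstile> isN Bot) \<in> J \<Longrightarrow> wf_term p \<Longrightarrow> follows J (\<Gamma> \<turnstile> p)"

| induction: "(\<Gamma> \<turnstile> subst i Zero c) \<in> J \<Longrightarrow>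
    (finsert (isN (Var i)) (finsert c \<Gamma>) \<turnstile> subst i (Succ (Var i)) c) \<in> J \<Longrightarrow>
    (\<Gamma> \<turnstile> isN a) \<in> J \<Longrightarrow> wf_term c \<Longrightarrow> (\<And>x. x |\<in>| \<Gamma> \<Longrightarrow> i \<notin> fv x) \<Longrightarrow>
    follows J (\<Gamma> \<turnstile> subst i a c)"

| conv_back: "c \<triangleright> c' \<Longrightarrow> (\<Gamma> \<turnstile> c') \<in> J \<Longrightarrow> follows J (\<Gamma> \<turnstile> c)"
| conv_fwd: "c \<triangleright> c' \<Longrightarrow> (\<Gamma> \<turnstile> c) \<in> J \<Longrightarrow> follows J (\<Gamma> \<turnstile> c')"
| conv_eq: "c \<triangleright> c' \<Longrightarrow> (\<Gamma> \<turnstile> isN c') \<in> J \<Longrightarrow> follows J (\<Gamma> \<turnstile> c \<^bold>= c')"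

| recursor: "(\<Gamma> \<turnstile> isN m) \<in> J \<Longrightarrow> (\<Gamma> \<turnstile> isN (h \<^bold>\<cdot> m \<^bold>\<cdot> (Rec \<^bold>\<cdot> g \<^bold>\<cdot> h \<^bold>\<cdot> m))) \<in> J \<Longrightarrow> wf_term g \<Longrightarrow>
    follows J (\<Gamma> \<turnstile> Rec \<^bold>\<cdot> g \<^bold>\<cdot> h \<^bold>\<cdot> Succ m \<^bold>= h \<^bold>\<cdot> m \<^bold>\<cdot> (Rec \<^bold>\<cdot> g \<^bold>\<cdot> h \<^bold>\<cdot> m))"

| all_I: "(finsert (isN (Var 0)) (lift |`| \<Gamma>) \<turnstile> lift f \<^bold>\<cdot> Var 0) \<in> J \<Longrightarrow>
    follows J (\<Gamma> \<turnstile> AllC \<^bold>\<cdot> f)"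
| all_E: "(\<Gamma> \<turnstile> AllC \<^bold>\<cdot> f) \<in> J \<Longrightarrow> (\<Gamma> \<turnstile> isN a) \<in> J \<Longrightarrow> follows J (\<Gamma> \<turnstile> f \<^bold>\<cdot> a)"
| not_all_I: "(\<Gamma> \<turnstile> \<^bold>\<not> (f \<^bold>\<cdot> a)) \<in> J \<Longrightarrow> (\<Gamma> \<turnstile> isN a) \<in> J \<Longrightarrow> follows J (\<Gamma> \<turnstile> \<^bold>\<not> (AllC \<^bold>\<cdot> f))"
| not_all_E: "(\<Gamma> \<turnstile> \<^bold>\<not> (AllC \<^bold>\<cdot> f)) \<in> J \<Longrightarrow>
    (finsert (isN (Var 0)) (finsert (\<^bold>\<not> (lift f \<^bold>\<cdot> Var 0)) (lift |`| \<Gamma>)) \<turnstile> lift c) \<in> J \<Longrightarrow>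
    follows J (\<Gamma> \<turnstile> c)"

definition valid_proof :: "sequent list \<Rightarrow> bool" where
  "valid_proof P \<longleftrightarrow> (\<forall>i<length P. follows (set (take i P)) (P ! i))"

definition proves :: "sequent list \<Rightarrow> sequent \<Rightarrow> bool" where
  "proves P j \<longleftrightarrow> valid_proof P \<and> j \<in> set P"

definition derivable :: "sequent \<Rightarrow> bool" where
  "derivable j \<longleftrightarrow> (\<exists>P. proves P j)"


section \<open>Goedel coding of proofs\<close>

text \<open>Evaluation depends on some fixed effective injective coding of proofs; this is one concrete
  choice, built from the computable encodings of pairs, sums, lists and finite sets.\<close>

fun term_code :: "rterm \<Rightarrow> nat" where
  "term_code (Var i) = sum_encode (Inl i)"
| "term_code (Op f k ts) =
     sum_encode (Inr (prod_encode (f, prod_encode (k, list_encode (map term_code ts)))))"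

fun sequent_code :: "sequent \<Rightarrow> nat" where
  "sequent_code (\<Gamma> \<turnstile> c) = prod_encode (set_encode (term_code ` fset \<Gamma>), term_code c)"

definition proof_code :: "sequent list \<Rightarrow> nat" where
  "proof_code P = list_encode (map sequent_code P)"

lemma inj_term_code: "inj term_code"
proof (rule injI)
  show "t = u" if "term_code t = term_code u" for t u
    using that
  proof (induction t arbitrary: u)
    case (Var i)
    then show ?case by (cases u) (auto simp: sum_encode_eq)
  next
    case (Op f k ts)
    then obtain us where u: "u = Op f k us" and eq: "map term_code ts = map term_code us"
      by (cases u) (auto simp: sum_encode_eq prod_encode_eq list_encode_eq)
    have "ts = us"
      using eq Op.IH by (auto simp: list_eq_iff_nth_eq map_equality_iff)
    then show ?case using u by simp
  qed
qed

lemma inj_sequent_code: "inj sequent_code"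
proof (rule injI)
  fix j j' assume eq: "sequent_code j = sequent_code j'"
  obtain \<Gamma> c \<Gamma>' c' where j: "j = (\<Gamma> \<turnstile> c)" "j' = (\<Gamma>' \<turnstile> c')"
    by (cases j, cases j')
  have "set_encode (term_code ` fset \<Gamma>) = set_encode (term_code ` fset \<Gamma>')"
    using eq j by (simp add: prod_encode_eq)
  then have "term_code ` fset \<Gamma> = term_code ` fset \<Gamma>'"
    by (simp add: set_encode_eq)
  then have "\<Gamma> = \<Gamma>'"
    using inj_image_eq_iff[OF inj_term_code] fset_inject by blast
  moreover have "c = c'"
    using eq j inj_term_code by (simp add: inj_eq prod_encode_eq)
  ultimately show "j = j'" using j by simp
qed

lemma inj_proof_code: "inj proof_code"
  unfolding proof_code_def
  by (rule injI) (simp add: list_encode_eq inj_map_eq_map[OF inj_sequent_code])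


section \<open>Evaluation\<close>

datatype head = HLam rterm | HRec | HRec1 rterm | HRec2 rterm rterm | HAll

abbreviation tt :: nat where "tt \<equiv> 1"
abbreviation ff :: nat where "ff \<equiv> 0"

text \<open>\<open>eval s t r\<close> is \<open>t \<Down>\<^sub>s r\<close>, and \<open>hd_eval s t w\<close> is its analogue for head shapes.\<close>

inductive eval :: "nat \<Rightarrow> rterm \<Rightarrow> nat \<Rightarrow> bool"
  and hd_eval :: "nat \<Rightarrow> rterm \<Rightarrow> head \<Rightarrow> bool" where
  eval_Zero: "eval (Suc s) Zero 0"
| eval_Succ: "eval s a n \<Longrightarrow> eval (Suc s) (Succ a) (n + 1)"
| eval_Eq: "eval s a m \<Longrightarrow> eval s b n \<Longrightarrow> eval (Suc s) (a \<^bold>= b) (if m = n then tt else ff)"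
| eval_Not_tt: "eval s a ff \<Longrightarrow> eval (Suc s) (\<^bold>\<not> a) tt"
| eval_Not_ff: "eval s a tt \<Longrightarrow> eval (Suc s) (\<^bold>\<not> a) ff"
| eval_Or_tt: "eval s a tt \<or> eval s b tt \<Longrightarrow> eval (Suc s) (a \<^bold>\<or> b) tt"
| eval_Or_ff: "eval s a ff \<Longrightarrow> eval s b ff \<Longrightarrow> eval (Suc s) (a \<^bold>\<or> b) ff"
| eval_Lam: "hd_eval s t (HLam b) \<Longrightarrow> eval s (inst b u) r \<Longrightarrow> eval (Suc s) (t \<^bold>\<cdot> u) r"
| eval_Rec_0: "hd_eval s t (HRec2 g h) \<Longrightarrow> eval s m 0 \<Longrightarrow> eval s g r \<Longrightarrow> eval (Suc s) (t \<^bold>\<cdot> m) r"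
| eval_Rec_Suc: "hd_eval s t (HRec2 g h) \<Longrightarrow> eval s m (k + 1) \<Longrightarrow>
    eval s (h \<^bold>\<cdot> num k \<^bold>\<cdot> (Rec \<^bold>\<cdot> g \<^bold>\<cdot> h \<^bold>\<cdot> num k)) r \<Longrightarrow> eval (Suc s) (t \<^bold>\<cdot> m) r"
| eval_All_tt: "hd_eval s t HAll \<Longrightarrow> proof_code P \<le> s \<Longrightarrow>
    proves P ({|isN (Var 0)|} \<turnstile> lift u \<^bold>\<cdot> Var 0) \<Longrightarrow> eval (Suc s) (t \<^bold>\<cdot> u) tt"
| eval_All_ff: "hd_eval s t HAll \<Longrightarrow> proof_code P \<le> s \<Longrightarrow>
    proves P ({||} \<turnstile> \<^bold>\<not> (u \<^bold>\<cdot> num i)) \<Longrightarrow> eval (Suc s) (t \<^bold>\<cdot> u) ff"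
| hd_Lam: "hd_eval (Suc s) (Lam b) (HLam b)"
| hd_Rec: "hd_eval (Suc s) Rec HRec"
| hd_All: "hd_eval (Suc s) AllC HAll"
| hd_Rec1: "hd_eval s t HRec \<Longrightarrow> hd_eval (Suc s) (t \<^bold>\<cdot> g) (HRec1 g)"
| hd_Rec2: "hd_eval s t (HRec1 g) \<Longrightarrow> hd_eval (Suc s) (t \<^bold>\<cdot> h) (HRec2 g h)"
| hd_App_Lam: "hd_eval s t (HLam b) \<Longrightarrow> hd_eval s (inst b u) w \<Longrightarrow> hd_eval (Suc s) (t \<^bold>\<cdot> u) w"
| hd_App_Rec_0: "hd_eval s t (HRec2 g h) \<Longrightarrow> eval s m 0 \<Longrightarrow> hd_eval s g w \<Longrightarrow>
    hd_eval (Suc s) (t \<^bold>\<cdot> m) w"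
| hd_App_Rec_Suc: "hd_eval s t (HRec2 g h) \<Longrightarrow> eval s m (k + 1) \<Longrightarrow>
    hd_eval s (h \<^bold>\<cdot> num k \<^bold>\<cdot> (Rec \<^bold>\<cdot> g \<^bold>\<cdot> h \<^bold>\<cdot> num k)) w \<Longrightarrow> hd_eval (Suc s) (t \<^bold>\<cdot> m) w"

end

theory Submission imports Defs begin

text \<open>
  \<open>AllC \<^bold>\<cdot> u\<close> evaluates to true only if the uniform sequent
  \<open>{|isN (Var 0)|} \<turnstile> lift u \<^bold>\<cdot> Var 0\<close> is derivable, so the task is to find a term all of whose
  numerical instances are derivable while its uniform version is not. Such a term arises from
  an asymmetry between the two ways of unfolding the recursor at a successor. The conversion
  rule works in every head position, in particular when the recursion returns a function, but
  only at literal numerals. The recursor rule works at arbitrary number terms, in particular at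
  variables, but only for recursions whose result is itself a number. A recursion that returns
  functions can therefore be unfolded at each numeral, yet never at a variable.

  The term \<open>witness\<close> maps \<open>x\<close> to \<open>Rec \<^bold>\<cdot> g \<^bold>\<cdot> h \<^bold>\<cdot> x \<^bold>\<cdot> Zero\<close>, where \<open>g\<close> is the constant function with
  value one and \<open>h\<close> hands the function obtained so far on unchanged. At a numeral \<open>n\<close>,
  conversions reduce \<open>witness \<^bold>\<cdot> num n\<close> to \<open>num 1\<close>, that is, to a true formula
  (\<open>derivable_witness\<close>).

  Underivability of the uniform version is a compactness argument over a family of models. The
  evaluation relation \<open>ev K\<close> reads the quantifier in the standard infinitary way and lets a
  recursion at \<open>Suc j\<close> with \<open>j \<ge> K\<close> return numbers only. All rules preserve validity in all
  these models, except that a recursor conversion at \<open>Suc n\<close> requires \<open>K > n\<close>. A proof performs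
  finitely many conversions, hence each proof is sound for some \<open>K\<close> (\<open>proof_sound\<close>). But in the
  model for \<open>K\<close> the term \<open>witness \<^bold>\<cdot> num (Suc K)\<close> has no value at all (\<open>not_ev_witness\<close>), so no proof
  contains the uniform sequent.
\<close>

(* Truth values are written 1 and 0 throughout, so simplification should keep 1 as it is. *)
declare One_nat_def [simp del]

section \<open>Closed parallel substitution\<close>

text \<open>Simultaneous replacement of all variables that are free below \<open>d\<close> binders. The terms
  \<open>\<sigma> i\<close> are meant to be closed, so they can be placed under binders without lifting.\<close>

fun psub :: "nat \<Rightarrow> (nat \<Rightarrow> rterm) \<Rightarrow> rterm \<Rightarrow> rterm" where
  "psub d \<sigma> (Var j) = (if j < d then Var j else \<sigma> (j - d))"
| "psub d \<sigma> (Op f k ts) = Op f k (map (psub (d + k) \<sigma>) ts)"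

definition closing :: "(nat \<Rightarrow> rterm) \<Rightarrow> bool" where
  "closing \<sigma> \<longleftrightarrow> (\<forall>i. closed_term (\<sigma> i))"

lemma fv_arg_bound:
  assumes "fv (Op f k ts) \<subseteq> {..<c}" and "t \<in> set ts"
  shows "fv t \<subseteq> {..<c + k}"
proof
  fix i assume i: "i \<in> fv t"
  show "i \<in> {..<c + k}"
  proof (cases "i < k")
    case False
    then have "i - k \<in> fv (Op f k ts)" using i assms(2) by auto
    then have "i - k < c" using assms(1) by blast
    then show ?thesis using False by simp
  qed simp
qed

lemma lift_from_above_fv: "fv t \<subseteq> {..<c} \<Longrightarrow> lift_from c t = t"
proof (induction c t rule: lift_from.induct)
  case (2 c f k ts)
  have "lift_from (c + k) t = t" if t: "t \<in> set ts" for t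
    using t 2(2) fv_arg_bound by (intro 2(1)) blast+
  then show ?case by (simp add: map_idI)
qed auto

lemma inst_at_above_fv: "fv t \<subseteq> {..<c} \<Longrightarrow> inst_at c s t = t"
proof (induction c s t rule: inst_at.induct)
  case (2 c s f k ts)
  have "inst_at (c + k) ((lift ^^ k) s) t = t" if t: "t \<in> set ts" for t
    using t 2(2) fv_arg_bound by (intro 2(1)) blast+
  then show ?case by (simp add: map_idI)
qed auto

lemma lift_from_closed: "closed_term t \<Longrightarrow> lift_from c t = t"
  by (simp add: closed_term_def lift_from_above_fv)

lemma inst_at_closed: "closed_term t \<Longrightarrow> inst_at c s t = t"
  by (simp add: closed_term_def inst_at_above_fv)

lemma funpow_lift_closed: "closed_term t \<Longrightarrow> (lift ^^ k) t = t"
  by (induction k) (auto simp: lift_from_closed)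

lemma funpow_lift_add: "(lift ^^ (d + k)) t = (lift ^^ k) ((lift ^^ d) t)"
  by (subst add.commute) (simp add: funpow_add)

lemma fv_psub: "closing \<sigma> \<Longrightarrow> fv (psub d \<sigma> t) \<subseteq> {..<d}"
proof (induction d \<sigma> t rule: psub.induct)
  case (1 d \<sigma> j)
  then show ?case by (auto simp: closing_def closed_term_def)
next
  case (2 d \<sigma> f k ts)
  then show ?case by (fastforce simp: subset_iff)
qed

lemma closed_psub: "closing \<sigma> \<Longrightarrow> closed_term (psub 0 \<sigma> t)"
  using fv_psub[of \<sigma> 0 t] by (auto simp: closed_term_def)

lemma closing_upd: "closing \<sigma> \<Longrightarrow> closed_term a \<Longrightarrow> closing (\<sigma>(i := a))"
  by (simp add: closing_def)

lemma closing_case_nat: "closing \<sigma> \<Longrightarrow> closed_term a \<Longrightarrow> closing (case_nat a \<sigma>)"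
  by (simp add: closing_def split: nat.split)

lemma closed_num: "closed_term (num n)"
  by (induction n) (auto simp: closed_term_def)

lemma psub_num [simp]: "psub d \<sigma> (num n) = num n"
  by (induction n) auto

lemma psub_lift_from:
  "closing \<sigma> \<Longrightarrow> psub (Suc (c + e)) \<sigma> (lift_from c t) = lift_from c (psub (c + e) \<sigma> t)"
proof (induction c t rule: lift_from.induct)
  case (1 c i)
  then show ?case by (auto simp: closing_def lift_from_closed)
next
  case (2 c f k ts)
  then show ?case by (auto simp: add.commute add.left_commute)
qed

lemma psub_funpow_lift:
  assumes "closing \<sigma>"
  shows "psub d \<sigma> ((lift ^^ d) s) = psub 0 \<sigma> s"
proof -
  have "psub d \<sigma> ((lift ^^ d) s) = (lift ^^ d) (psub 0 \<sigma> s)"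
  proof (induction d)
    case (Suc d)
    then show ?case using psub_lift_from[OF assms, of 0 d] by simp
  qed simp
  then show ?thesis by (simp add: funpow_lift_closed closed_psub assms)
qed

text \<open>A closing substitution plays the part of an assignment. Under it, the syntactic operations
  \<open>subst\<close>, \<open>inst\<close> and \<open>lift\<close> become changes of the assignment, here and in the lemmas that follow. The general \<open>d\<close> is needed to pass
  under binders; the case \<open>d = 0\<close> is the one of interest.\<close>

lemma psub_subst:
  assumes "closing \<sigma>"
  shows "psub d \<sigma> (subst (i + d) ((lift ^^ d) s) t) = psub d (\<sigma>(i := psub 0 \<sigma> s)) t"
proof (induction t arbitrary: d)
  case (Var j)
  then show ?case using assms by (auto simp: psub_funpow_lift)
next
  case (Op f k ts)
  have "psub (d + k) \<sigma> (subst (i + d + k) ((lift ^^ k) ((lift ^^ d) s)) t)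
      = psub (d + k) (\<sigma>(i := psub 0 \<sigma> s)) t" if "t \<in> set ts" for t
    using Op[OF that, of "d + k"] by (simp only: funpow_lift_add add.assoc)
  then show ?case by (simp del: fun_upd_apply)
qed

lemma psub_subst_0:
  "closing \<sigma> \<Longrightarrow> psub 0 \<sigma> (subst i s t) = psub 0 (\<sigma>(i := psub 0 \<sigma> s)) t"
  using psub_subst[of \<sigma> 0 i s t] by simp

lemma psub_inst_at:
  assumes "closing \<sigma>"
  shows "psub d \<sigma> (inst_at d ((lift ^^ d) s) t) = psub d (case_nat (psub 0 \<sigma> s) \<sigma>) t"
proof (induction t arbitrary: d)
  case (Var j)
  consider "j < d" | "j = d" | e where "j = Suc (d + e)"
    by (metis less_imp_Suc_add linorder_neqE_nat)
  then show ?case using assms by cases (auto simp: psub_funpow_lift)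
next
  case (Op f k ts)
  have "psub (d + k) \<sigma> (inst_at (d + k) ((lift ^^ k) ((lift ^^ d) s)) t)
      = psub (d + k) (case_nat (psub 0 \<sigma> s) \<sigma>) t" if "t \<in> set ts" for t
    using Op[OF that, of "d + k"] by (simp add: funpow_lift_add)
  then show ?case by simp
qed

lemma inst_at_psub:
  assumes "closing \<sigma>" and "closed_term s"
  shows "inst_at d s (psub (Suc d) \<sigma> t) = psub d (case_nat s \<sigma>) t"
proof (induction t arbitrary: d)
  case (Var j)
  consider "j < d" | "j = d" | e where "j = Suc (d + e)"
    by (metis less_imp_Suc_add linorder_neqE_nat)
  then show ?case using assms by cases (auto simp: inst_at_closed closing_def)
next
  case (Op f k ts)
  then show ?case using assms by (simp add: funpow_lift_closed)
qed

lemma psub_inst: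
  assumes "closing \<sigma>"
  shows "psub 0 \<sigma> (inst b t) = inst (psub 1 \<sigma> b) (psub 0 \<sigma> t)"
  using psub_inst_at[OF assms, of 0 t b]
    inst_at_psub[OF assms closed_psub[OF assms, of t], of 0 b] by (simp add: One_nat_def)

lemma psub_lift_at: "psub d (case_nat a \<sigma>) (lift_from d t) = psub d \<sigma> t"
proof (induction d t rule: lift_from.induct)
  case (1 c i)
  then show ?case by (auto simp: Suc_diff_le)
next
  case (2 c f k ts)
  then show ?case by auto
qed

lemma psub_upd_fresh: "i + d \<notin> fv t \<Longrightarrow> psub d (\<sigma>(i := a)) t = psub d \<sigma> t"
proof (induction t arbitrary: d)
  case (Op f k ts)
  then show ?case by (auto simp: add.assoc)
qed auto


section \<open>Truncated evaluation\<close>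

text \<open>Numbers and head shapes are put into one type of outcomes, so that a single relation covers
  value and head evaluation. It is polymorphic in the subterms that head shapes
  carry, so that relations between terms extend to outcomes by \<open>rel_outcome\<close>.\<close>

datatype 't outcome = Val nat | Fun 't | Rec0 | Rec1 't | Rec2 't 't | ForAll

text \<open>The models of the calculus. In contrast to \<open>eval\<close>, the quantifier is not evaluated by proof search
  but by its truth conditions over the numerals, which makes the relation infinitary. The
  cutoff \<open>K\<close> acts in \<open>App_Rec2_Suc\<close> only: from step \<open>K\<close> on, a recursion may produce a number
  but no head shape. Number results must stay unrestricted, because the recursor rule unfolds
  them at arbitrary arguments.\<close>

inductive ev :: "nat \<Rightarrow> rterm \<Rightarrow> rterm outcome \<Rightarrow> bool" for K :: nat where
  Zero: "ev K Zero (Val 0)"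
| Succ: "ev K a (Val n) \<Longrightarrow> ev K (Succ a) (Val (Suc n))"
| Eq: "ev K a (Val m) \<Longrightarrow> ev K b (Val n) \<Longrightarrow> ev K (a \<^bold>= b) (Val (if m = n then tt else ff))"
| Not_tt: "ev K a (Val ff) \<Longrightarrow> ev K (\<^bold>\<not> a) (Val tt)"
| Not_ff: "ev K a (Val tt) \<Longrightarrow> ev K (\<^bold>\<not> a) (Val ff)"
| Or_tt1: "ev K a (Val tt) \<Longrightarrow> ev K (a \<^bold>\<or> b) (Val tt)"
| Or_tt2: "ev K b (Val tt) \<Longrightarrow> ev K (a \<^bold>\<or> b) (Val tt)"
| Or_ff: "ev K a (Val ff) \<Longrightarrow> ev K b (Val ff) \<Longrightarrow> ev K (a \<^bold>\<or> b) (Val ff)"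
| Lam: "ev K (Lam b) (Fun b)"
| Rec: "ev K Rec Rec0"
| All: "ev K AllC ForAll"
| App_Rec0: "ev K t Rec0 \<Longrightarrow> ev K (t \<^bold>\<cdot> g) (Rec1 g)"
| App_Rec1: "ev K t (Rec1 g) \<Longrightarrow> ev K (t \<^bold>\<cdot> h) (Rec2 g h)"
| App_Fun: "ev K t (Fun b) \<Longrightarrow> ev K (inst b u) w \<Longrightarrow> ev K (t \<^bold>\<cdot> u) w"
| App_Rec2_0: "ev K t (Rec2 g h) \<Longrightarrow> ev K m (Val 0) \<Longrightarrow> ev K g w \<Longrightarrow> ev K (t \<^bold>\<cdot> m) w"
| App_Rec2_Suc: "ev K t (Rec2 g h) \<Longrightarrow> ev K m (Val (Suc j)) \<Longrightarrow>
    ev K (h \<^bold>\<cdot> num j \<^bold>\<cdot> (Rec \<^bold>\<cdot> g \<^bold>\<cdot> h \<^bold>\<cdot> num j)) w \<Longrightarrow> j < K \<or> (\<exists>n. w = Val n) \<Longrightarrow>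
    ev K (t \<^bold>\<cdot> m) w"
| App_All_tt: "ev K t ForAll \<Longrightarrow> (\<And>n. ev K (u \<^bold>\<cdot> num n) (Val tt)) \<Longrightarrow> ev K (t \<^bold>\<cdot> u) (Val tt)"
| App_All_ff: "ev K t ForAll \<Longrightarrow> ev K (u \<^bold>\<cdot> num n) (Val ff) \<Longrightarrow> ev K (t \<^bold>\<cdot> u) (Val ff)"

lemma ev_Zero [simp]: "ev K Zero w \<longleftrightarrow> w = Val 0"
  by (auto elim: ev.cases intro: ev.intros)

lemma ev_Bot [simp]: "\<not> ev K Bot w"
  by (auto elim: ev.cases)

lemma ev_Lam [simp]: "ev K (Lam b) w \<longleftrightarrow> w = Fun b"
  by (auto elim: ev.cases intro: ev.intros)

lemma ev_Rec [simp]: "ev K Rec w \<longleftrightarrow> w = Rec0"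
  by (auto elim: ev.cases intro: ev.intros)

lemma ev_All [simp]: "ev K AllC w \<longleftrightarrow> w = ForAll"
  by (auto elim: ev.cases intro: ev.intros)

lemma ev_Succ [simp]: "ev K (Succ a) w \<longleftrightarrow> (\<exists>n. w = Val (Suc n) \<and> ev K a (Val n))"
  by (auto elim: ev.cases intro: ev.intros)

lemma ev_Eq [simp]: "ev K (a \<^bold>= b) w \<longleftrightarrow>
    (\<exists>m n. ev K a (Val m) \<and> ev K b (Val n) \<and> w = Val (if m = n then tt else ff))"
  by (rule iffI, erule ev.cases) (auto intro: ev.Eq)

lemma ev_Not [simp]: "ev K (\<^bold>\<not> a) w \<longleftrightarrow>
    ev K a (Val ff) \<and> w = Val tt \<or> ev K a (Val tt) \<and> w = Val ff"
  by (rule iffI, erule ev.cases) (auto intro: ev.Not_tt ev.Not_ff)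

lemma ev_Or [simp]: "ev K (a \<^bold>\<or> b) w \<longleftrightarrow>
    (ev K a (Val tt) \<or> ev K b (Val tt)) \<and> w = Val tt \<or>
    ev K a (Val ff) \<and> ev K b (Val ff) \<and> w = Val ff"
  by (rule iffI, erule ev.cases)
    (auto intro: ev.Or_tt1 ev.Or_tt2 ev.Or_ff)

text \<open>Not a simplification rule: the right-hand side contains applications again.\<close>

lemma ev_App: "ev K (t \<^bold>\<cdot> u) w \<longleftrightarrow>
    ev K t Rec0 \<and> w = Rec1 u \<or>
    (\<exists>g. ev K t (Rec1 g) \<and> w = Rec2 g u) \<or>
    (\<exists>b. ev K t (Fun b) \<and> ev K (inst b u) w) \<or>
    (\<exists>g h. ev K t (Rec2 g h) \<and> ev K u (Val 0) \<and> ev K g w) \<or>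
    (\<exists>g h j. ev K t (Rec2 g h) \<and> ev K u (Val (Suc j)) \<and>
       ev K (h \<^bold>\<cdot> num j \<^bold>\<cdot> (Rec \<^bold>\<cdot> g \<^bold>\<cdot> h \<^bold>\<cdot> num j)) w \<and> (j < K \<or> (\<exists>n. w = Val n))) \<or>
    ev K t ForAll \<and> (\<forall>n. ev K (u \<^bold>\<cdot> num n) (Val tt)) \<and> w = Val tt \<or>
    ev K t ForAll \<and> (\<exists>n. ev K (u \<^bold>\<cdot> num n) (Val ff)) \<and> w = Val ff" (is "?L \<longleftrightarrow> ?R")
proof
  show "?L \<Longrightarrow> ?R" by (erule ev.cases) auto
  show "?R \<Longrightarrow> ?L" by (elim disjE exE conjE) (blast intro: ev.intros)+
qed

lemma ev_num: "ev K (num n) (Val n)"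
  by (induction n) auto

lemma ev_deterministic: "ev K t w \<Longrightarrow> ev K t w' \<Longrightarrow> w = w'"
proof (induction arbitrary: w' rule: ev.induct)
  case (App_Rec0 t g)
  from ev_App[THEN iffD1, OF App_Rec0.prems] show ?case
    by (elim disjE exE conjE) (auto dest: App_Rec0.IH)
next
  case (App_Rec1 t g h)
  from ev_App[THEN iffD1, OF App_Rec1.prems] show ?case
    by (elim disjE exE conjE) (auto dest: App_Rec1.IH)
next
  case (App_Fun t b u w)
  from ev_App[THEN iffD1, OF App_Fun.prems] show ?case
    by (elim disjE exE conjE) (auto dest: App_Fun.IH)
next
  case (App_Rec2_0 t g h m w)
  from ev_App[THEN iffD1, OF App_Rec2_0.prems] show ?case
    by (elim disjE exE conjE) (auto dest: App_Rec2_0.IH)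
next
  case (App_Rec2_Suc t g h m j w)
  from ev_App[THEN iffD1, OF App_Rec2_Suc.prems] show ?case
    by (elim disjE exE conjE) (auto dest: App_Rec2_Suc.IH)
next
  case (App_All_tt t u)
  have "\<not> ev K (u \<^bold>\<cdot> num n) (Val ff)" for n using App_All_tt.IH(2)[of n "Val ff"] by auto
  moreover from ev_App[THEN iffD1, OF App_All_tt.prems]
  have "w' = Val tt \<or> (\<exists>n. ev K (u \<^bold>\<cdot> num n) (Val ff))"
    by (elim disjE exE conjE) (auto dest: App_All_tt.IH(1))
  ultimately show ?case by blast
next
  case (App_All_ff t u n)
  have "\<not> ev K (u \<^bold>\<cdot> num n) (Val tt)" using App_All_ff.IH(2)[of "Val tt"] by auto
  moreover from ev_App[THEN iffD1, OF App_All_ff.prems]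
  have "w' = Val ff \<or> (\<forall>n. ev K (u \<^bold>\<cdot> num n) (Val tt))"
    by (elim disjE exE conjE) (auto dest: App_All_ff.IH(1))
  ultimately show ?case by blast
next
  case (Succ a n)
  from Succ.prems show ?case by (auto dest: Succ.IH)
next
  case (Eq a m b n)
  from Eq.prems show ?case by (auto dest!: Eq.IH)
next
  case (Not_tt a)
  from Not_tt.prems show ?case by (auto dest: Not_tt.IH)
next
  case (Not_ff a)
  from Not_ff.prems show ?case by (auto dest: Not_ff.IH)
next
  case (Or_tt1 a b)
  from Or_tt1.prems show ?case by (auto dest: Or_tt1.IH)
next
  case (Or_tt2 b a)
  from Or_tt2.prems show ?case by (auto dest: Or_tt2.IH)
next
  case (Or_ff a b)
  from Or_ff.prems show ?case by (auto dest: Or_ff.IH)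
qed simp_all


lemma ev_num_iff: "ev K (num n) w \<longleftrightarrow> w = Val n"
  using ev_num ev_deterministic by blast


section \<open>Interchangeable terms\<close>

text \<open>The congruence generated by identifying closed terms that have the same number as value. It
  has to relate open terms and terms with free variables under binders as well, because
  evaluation instantiates bodies of abstractions.\<close>

inductive interch :: "nat \<Rightarrow> rterm \<Rightarrow> rterm \<Rightarrow> bool" for K :: nat where
  same_value: "closed_term a \<Longrightarrow> closed_term b \<Longrightarrow> ev K a (Val n) \<Longrightarrow> ev K b (Val n) \<Longrightarrow>
    interch K a b"
| Var: "interch K (Var i) (Var i)"
| Op: "list_all2 (interch K) ts us \<Longrightarrow> interch K (Op f k ts) (Op f k us)"
monos list_all2_mono

lemma interch_refl [simp, intro]: "interch K t t"
proof (induction t)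
  case (Op f k ts)
  then show ?case by (intro interch.Op) (simp add: list_all2_same)
qed (rule interch.Var)

lemma interch_lift_from: "interch K t t' \<Longrightarrow> interch K (lift_from c t) (lift_from c t')"
proof (induction arbitrary: c rule: interch.induct)
  case (same_value a b n)
  then show ?case by (simp add: lift_from_closed interch.same_value)
next
  case (Op ts us f k)
  then have "list_all2 (\<lambda>t u. interch K (lift_from (c + k) t) (lift_from (c + k) u)) ts us"
    by (auto elim: list_all2_mono)
  then show ?case by (simp add: interch.Op list_all2_map1 list_all2_map2)
qed simp

lemma interch_funpow_lift: "interch K t t' \<Longrightarrow> interch K ((lift ^^ k) t) ((lift ^^ k) t')"
  by (induction k) (auto intro: interch_lift_from)

lemma interch_inst_at:
  "interch K t t' \<Longrightarrow> interch K s s' \<Longrightarrow> interch K (inst_at c s t) (inst_at c s' t')"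
proof (induction arbitrary: c s s' rule: interch.induct)
  case (same_value a b n)
  then show ?case by (simp add: inst_at_closed interch.same_value)
next
  case (Op ts us f k)
  have "list_all2 (\<lambda>t u. interch K (inst_at (c + k) ((lift ^^ k) s) t)
      (inst_at (c + k) ((lift ^^ k) s') u)) ts us"
    using Op interch_funpow_lift by (auto elim!: list_all2_mono)
  then show ?case by (simp add: interch.Op list_all2_map1 list_all2_map2)
qed simp

lemma interch_psub:
  assumes "\<And>i. interch K (\<sigma> i) (\<tau> i)"
  shows "interch K (psub d \<sigma> t) (psub d \<tau> t)"
proof (induction t arbitrary: d)
  case (Op f k ts)
  then show ?case
    by (auto intro!: interch.Op simp: list_all2_map1 list_all2_map2 list_all2_same)
qed (simp add: assms)

lemma rel_outcome_simps [simp]: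
  "rel_outcome R (Val n) w \<longleftrightarrow> w = Val n"
  "rel_outcome R Rec0 w \<longleftrightarrow> w = Rec0"
  "rel_outcome R ForAll w \<longleftrightarrow> w = ForAll"
  "rel_outcome R (Fun b) w \<longleftrightarrow> (\<exists>b'. w = Fun b' \<and> R b b')"
  "rel_outcome R (Rec1 g) w \<longleftrightarrow> (\<exists>g'. w = Rec1 g' \<and> R g g')"
  "rel_outcome R (Rec2 g h) w \<longleftrightarrow> (\<exists>g' h'. w = Rec2 g' h' \<and> R g g' \<and> R h h')"
  by (cases w; auto)+

lemma interch_App: "interch K t t' \<Longrightarrow> interch K u u' \<Longrightarrow> interch K (t \<^bold>\<cdot> u) (t' \<^bold>\<cdot> u')"
  by (simp add: interch.Op)

text \<open>If related terms are related because they share a value, determinism settles the claim at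
  once. Hence only terms with the same outermost operator and related arguments have to be
  considered when evaluation is followed step by step.\<close>

lemma interch_ev_cases:
  assumes "ev K (Op f k ts) w" and "interch K (Op f k ts) t'"
    and "\<And>us. t' = Op f k us \<Longrightarrow> list_all2 (interch K) ts us \<Longrightarrow>
      \<exists>w'. ev K t' w' \<and> rel_outcome (interch K) w w'"
  shows "\<exists>w'. ev K t' w' \<and> rel_outcome (interch K) w w'"
  using assms(2)
proof cases
  case (same_value n)
  then have "w = Val n" using assms(1) ev_deterministic by blast
  then show ?thesis using same_value by auto
qed (use assms(3) in auto)

text \<open>Evaluation cannot distinguish terms with the same number as value, not even through functions.
  This is where the cutoff must not break the congruence: it depends on the value of the
  recursion argument only, not on the way the argument is written.\<close>

lemma ev_interch:
  "ev K t w \<Longrightarrow> interch K t t' \<Longrightarrow> \<exists>w'. ev K t' w' \<and> rel_outcome (interch K) w w'"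
proof (induction arbitrary: t' rule: ev.induct)
  case (App_Rec0 t g)
  show ?case
    by (rule interch_ev_cases[OF ev.App_Rec0[OF App_Rec0.hyps] App_Rec0.prems])
      (fastforce simp: list_all2_Cons1 dest!: App_Rec0.IH intro: ev.App_Rec0)
next
  case (App_Rec1 t g h)
  show ?case
    by (rule interch_ev_cases[OF ev.App_Rec1[OF App_Rec1.hyps] App_Rec1.prems])
      (fastforce simp: list_all2_Cons1 dest!: App_Rec1.IH intro: ev.App_Rec1)
next
  case (App_Fun t b u w)
  show ?case
  proof (rule interch_ev_cases[OF ev.App_Fun[OF App_Fun.hyps] App_Fun.prems])
    fix us assume "t' = Op 9 0 us" "list_all2 (interch K) [t, u] us"
    then obtain t1 u1 where t': "t' = t1 \<^bold>\<cdot> u1" and t: "interch K t t1" and u: "interch K u u1"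
      by (auto simp: list_all2_Cons1)
    obtain b1 where b1: "ev K t1 (Fun b1)" "interch K b b1"
      using App_Fun.IH(1)[OF t] by auto
    obtain w1 where "ev K (inst b1 u1) w1" "rel_outcome (interch K) w w1"
      using App_Fun.IH(2)[OF interch_inst_at[OF b1(2) u]] by auto
    then show "\<exists>w'. ev K t' w' \<and> rel_outcome (interch K) w w'"
      using t' b1 ev.App_Fun by blast
  qed
next
  case (App_Rec2_0 t g h m w)
  show ?case
  proof (rule interch_ev_cases[OF ev.App_Rec2_0[OF App_Rec2_0.hyps] App_Rec2_0.prems])
    fix us assume "t' = Op 9 0 us" "list_all2 (interch K) [t, m] us"
    then obtain t1 m1 where t': "t' = t1 \<^bold>\<cdot> m1" and t: "interch K t t1" and m: "interch K m m1"
      by (auto simp: list_all2_Cons1)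
    obtain g1 h1 where g1: "ev K t1 (Rec2 g1 h1)" "interch K g g1"
      using App_Rec2_0.IH(1)[OF t] by auto
    have "ev K m1 (Val 0)" using App_Rec2_0.IH(2)[OF m] by simp
    then show "\<exists>w'. ev K t' w' \<and> rel_outcome (interch K) w w'"
      using t' g1 App_Rec2_0.IH(3)[OF g1(2)] ev.App_Rec2_0 by blast
  qed
next
  case (App_Rec2_Suc t g h m j w)
  show ?case
  proof (rule interch_ev_cases[OF ev.App_Rec2_Suc[OF App_Rec2_Suc.hyps] App_Rec2_Suc.prems])
    fix us assume "t' = Op 9 0 us" "list_all2 (interch K) [t, m] us"
    then obtain t1 m1 where t': "t' = t1 \<^bold>\<cdot> m1" and t: "interch K t t1" and m: "interch K m m1"
      by (auto simp: list_all2_Cons1)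
    obtain g1 h1 where g1: "ev K t1 (Rec2 g1 h1)" "interch K g g1" "interch K h h1"
      using App_Rec2_Suc.IH(1)[OF t] by auto
    have m1: "ev K m1 (Val (Suc j))" using App_Rec2_Suc.IH(2)[OF m] by simp
    have "interch K (h \<^bold>\<cdot> num j \<^bold>\<cdot> (Rec \<^bold>\<cdot> g \<^bold>\<cdot> h \<^bold>\<cdot> num j))
        (h1 \<^bold>\<cdot> num j \<^bold>\<cdot> (Rec \<^bold>\<cdot> g1 \<^bold>\<cdot> h1 \<^bold>\<cdot> num j))"
      using g1 by (intro interch_App interch_refl)
    from App_Rec2_Suc.IH(3)[OF this] obtain w1
      where w1: "ev K (h1 \<^bold>\<cdot> num j \<^bold>\<cdot> (Rec \<^bold>\<cdot> g1 \<^bold>\<cdot> h1 \<^bold>\<cdot> num j)) w1"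
        "rel_outcome (interch K) w w1" by blast
    have "j < K \<or> (\<exists>n. w1 = Val n)" using App_Rec2_Suc.hyps w1(2) by auto
    then show "\<exists>w'. ev K t' w' \<and> rel_outcome (interch K) w w'"
      using t' ev.App_Rec2_Suc[OF g1(1) m1 w1(1)] w1(2) by blast
  qed
next
  case (App_All_tt t u)
  show ?case
  proof (rule interch_ev_cases[OF ev.App_All_tt[OF App_All_tt.hyps] App_All_tt.prems])
    fix us assume "t' = Op 9 0 us" "list_all2 (interch K) [t, u] us"
    then obtain t1 u1 where t': "t' = t1 \<^bold>\<cdot> u1" and t: "interch K t t1" and u: "interch K u u1"
      by (auto simp: list_all2_Cons1)
    have "ev K (u1 \<^bold>\<cdot> num n) (Val tt)" for n
      using App_All_tt.IH(2)[OF interch_App[OF u interch_refl]] by simp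
    then show "\<exists>w'. ev K t' w' \<and> rel_outcome (interch K) (Val tt) w'"
      using t' App_All_tt.IH(1)[OF t] by (auto intro: ev.App_All_tt)
  qed
next
  case (App_All_ff t u n)
  show ?case
  proof (rule interch_ev_cases[OF ev.App_All_ff[OF App_All_ff.hyps] App_All_ff.prems])
    fix us assume "t' = Op 9 0 us" "list_all2 (interch K) [t, u] us"
    then obtain t1 u1 where t': "t' = t1 \<^bold>\<cdot> u1" and t: "interch K t t1" and u: "interch K u u1"
      by (auto simp: list_all2_Cons1)
    have "ev K (u1 \<^bold>\<cdot> num n) (Val ff)"
      using App_All_ff.IH(2)[OF interch_App[OF u interch_refl]] by simp
    then show "\<exists>w'. ev K t' w' \<and> rel_outcome (interch K) (Val ff) w'"
      using t' App_All_ff.IH(1)[OF t] by (auto intro: ev.App_All_ff)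
  qed
next
  case (Lam b)
  show ?case
    by (rule interch_ev_cases[OF ev.Lam Lam.prems]) (auto simp: list_all2_Cons1)
next
  case Zero
  show ?case by (rule interch_ev_cases[OF ev.Zero Zero.prems]) auto
next
  case Rec
  show ?case by (rule interch_ev_cases[OF ev.Rec Rec.prems]) auto
next
  case All
  show ?case by (rule interch_ev_cases[OF ev.All All.prems]) auto
next
  case (Succ a n)
  show ?case
    by (rule interch_ev_cases[OF ev.Succ[OF Succ.hyps] Succ.prems])
      (auto simp: list_all2_Cons1 dest!: Succ.IH)
next
  case (Eq a m b n)
  show ?case
  proof (rule interch_ev_cases[OF ev.Eq[OF Eq.hyps] Eq.prems])
    fix us assume "t' = Op 7 0 us" "list_all2 (interch K) [a, b] us"
    then obtain a1 b1 where t': "t' = (a1 \<^bold>= b1)" and a: "interch K a a1" and b: "interch K b b1"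
      by (auto simp: list_all2_Cons1)
    have "ev K t' (Val (if m = n then tt else ff))"
      unfolding t' using Eq.IH(1)[OF a] Eq.IH(2)[OF b] by (intro ev.Eq) simp_all
    then show "\<exists>w'. ev K t' w' \<and>
        rel_outcome (interch K) (Val (if m = n then tt else ff)) w'" by fastforce
  qed
next
  case (Not_tt a)
  show ?case
    by (rule interch_ev_cases[OF ev.Not_tt[OF Not_tt.hyps] Not_tt.prems])
      (auto simp: list_all2_Cons1 dest!: Not_tt.IH)
next
  case (Not_ff a)
  show ?case
    by (rule interch_ev_cases[OF ev.Not_ff[OF Not_ff.hyps] Not_ff.prems])
      (auto simp: list_all2_Cons1 dest!: Not_ff.IH)
next
  case (Or_tt1 a b)
  show ?case
    by (rule interch_ev_cases[OF ev.Or_tt1[OF Or_tt1.hyps] Or_tt1.prems])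
      (auto simp: list_all2_Cons1 dest!: Or_tt1.IH)
next
  case (Or_tt2 b a)
  show ?case
    by (rule interch_ev_cases[OF ev.Or_tt2[OF Or_tt2.hyps] Or_tt2.prems])
      (auto simp: list_all2_Cons1 dest!: Or_tt2.IH)
next
  case (Or_ff a b)
  show ?case
    by (rule interch_ev_cases[OF ev.Or_ff[OF Or_ff.hyps] Or_ff.prems])
      (auto simp: list_all2_Cons1 dest!: Or_ff.IH)
qed

lemma ev_Val_interch: "ev K t (Val n) \<Longrightarrow> interch K t t' \<Longrightarrow> ev K t' (Val n)"
  using ev_interch by fastforce


section \<open>Soundness\<close>

text \<open>The condition under which conversion between \<open>c\<close> and \<open>c'\<close> is sound in the model for \<open>K\<close>. It
  covers all outcomes, not just numbers, so that it passes from \<open>t\<close> to \<open>t \<^bold>\<cdot> u\<close>.\<close>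

definition conv_ok :: "nat \<Rightarrow> rterm \<Rightarrow> rterm \<Rightarrow> bool" where
  "conv_ok K c c' \<longleftrightarrow>
    (\<forall>\<sigma> w. closing \<sigma> \<longrightarrow> (ev K (psub 0 \<sigma> c) w \<longleftrightarrow> ev K (psub 0 \<sigma> c') w))"

lemma ev_beta: "ev K (Lam b \<^bold>\<cdot> t) w \<longleftrightarrow> ev K (inst b t) w"
  by (subst ev_App) simp

lemma ev_All_App: "ev K (AllC \<^bold>\<cdot> f) w \<longleftrightarrow>
    (\<forall>n. ev K (f \<^bold>\<cdot> num n) (Val tt)) \<and> w = Val tt \<or>
    (\<exists>n. ev K (f \<^bold>\<cdot> num n) (Val ff)) \<and> w = Val ff"
  by (subst ev_App) simp

lemma ev_Rec_g: "ev K (Rec \<^bold>\<cdot> g) w \<longleftrightarrow> w = Rec1 g"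
  by (subst ev_App) simp

lemma ev_Rec_gh: "ev K (Rec \<^bold>\<cdot> g \<^bold>\<cdot> h) w \<longleftrightarrow> w = Rec2 g h"
  by (subst ev_App) (simp add: ev_Rec_g)

lemma ev_Rec_Zero: "ev K (Rec \<^bold>\<cdot> g \<^bold>\<cdot> h \<^bold>\<cdot> Zero) w \<longleftrightarrow> ev K g w"
  by (subst ev_App) (simp add: ev_Rec_gh)

lemma ev_Rec_Succ:
  assumes "ev K m (Val j)"
  shows "ev K (Rec \<^bold>\<cdot> g \<^bold>\<cdot> h \<^bold>\<cdot> Succ m) w \<longleftrightarrow>
    ev K (h \<^bold>\<cdot> num j \<^bold>\<cdot> (Rec \<^bold>\<cdot> g \<^bold>\<cdot> h \<^bold>\<cdot> num j)) w \<and> (j < K \<or> (\<exists>n. w = Val n))"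
  using assms ev_deterministic[OF assms]
  by (subst ev_App) (auto simp: ev_Rec_gh)

text \<open>A recursor step at \<open>Succ (num n)\<close> is harmless once the cutoff exceeds \<open>n\<close>; the other steps
  are harmless for every cutoff. This is the only place where a bound on \<open>K\<close> arises.\<close>

lemma head_step_conv_ok: "c \<triangleright> c' \<Longrightarrow> \<exists>K0. \<forall>K\<ge>K0. conv_ok K c c'"
proof (induction rule: head_step.induct)
  case (beta t b)
  show ?case by (simp add: conv_ok_def ev_beta psub_inst)
next
  case (rec_0 h g)
  show ?case by (simp add: conv_ok_def ev_Rec_Zero)
next
  case (rec_Suc g h n)
  have "conv_ok K (Rec \<^bold>\<cdot> g \<^bold>\<cdot> h \<^bold>\<cdot> Succ (num n)) (h \<^bold>\<cdot> num n \<^bold>\<cdot> (Rec \<^bold>\<cdot> g \<^bold>\<cdot> h \<^bold>\<cdot> num n))"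
    if "Suc n \<le> K" for K
    using that by (simp add: conv_ok_def ev_Rec_Succ[OF ev_num])
  then show ?case by blast
next
  case (app t t' u)
  have "conv_ok K (t \<^bold>\<cdot> u) (t' \<^bold>\<cdot> u)" if "conv_ok K t t'" for K
    unfolding conv_ok_def
  proof (intro allI impI)
    fix \<sigma> w assume "closing \<sigma>"
    then have eq: "ev K (psub 0 \<sigma> t) = ev K (psub 0 \<sigma> t')"
      using that by (auto simp: conv_ok_def)
    show "ev K (psub 0 \<sigma> (t \<^bold>\<cdot> u)) w \<longleftrightarrow> ev K (psub 0 \<sigma> (t' \<^bold>\<cdot> u)) w"
      using ev_App[of K "psub 0 \<sigma> t" "psub 0 \<sigma> u" w] ev_App[of K "psub 0 \<sigma> t'" "psub 0 \<sigma> u" w]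
      unfolding eq by simp
  qed
  then show ?case using app.IH by blast
qed

definition sat :: "nat \<Rightarrow> (nat \<Rightarrow> rterm) \<Rightarrow> rterm \<Rightarrow> bool" where
  "sat K \<sigma> c \<longleftrightarrow> ev K (psub 0 \<sigma> c) (Val tt)"

fun valid :: "nat \<Rightarrow> sequent \<Rightarrow> bool" where
  "valid K (\<Gamma> \<turnstile> c) \<longleftrightarrow> (\<forall>\<sigma>. closing \<sigma> \<longrightarrow> (\<forall>x. x |\<in>| \<Gamma> \<longrightarrow> sat K \<sigma> x) \<longrightarrow> sat K \<sigma> c)"

lemma sat_subst: "closing \<sigma> \<Longrightarrow> sat K \<sigma> (subst i s t) \<longleftrightarrow> sat K (\<sigma>(i := psub 0 \<sigma> s)) t"
  by (simp add: sat_def psub_subst_0)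

lemma sat_isN: "sat K \<sigma> (isN a) \<longleftrightarrow> (\<exists>n. ev K (psub 0 \<sigma> a) (Val n))"
  using ev_deterministic by (fastforce simp: sat_def)

lemma sat_Eq: "sat K \<sigma> (a \<^bold>= b) \<longleftrightarrow> (\<exists>n. ev K (psub 0 \<sigma> a) (Val n) \<and> ev K (psub 0 \<sigma> b) (Val n))"
  by (auto simp: sat_def)

lemma sat_connectives:
  "sat K \<sigma> (a \<^bold>= num 1) \<longleftrightarrow> sat K \<sigma> a"
  "sat K \<sigma> (a \<^bold>= Zero) \<longleftrightarrow> sat K \<sigma> (\<^bold>\<not> a)"
  "sat K \<sigma> (\<^bold>\<not> \<^bold>\<not> a) \<longleftrightarrow> sat K \<sigma> a"
  "sat K \<sigma> (a \<^bold>\<or> b) \<longleftrightarrow> sat K \<sigma> a \<or> sat K \<sigma> b"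
  "sat K \<sigma> (\<^bold>\<not> (a \<^bold>\<or> b)) \<longleftrightarrow> sat K \<sigma> (\<^bold>\<not> a) \<and> sat K \<sigma> (\<^bold>\<not> b)"
  by (auto simp: sat_def ev_num_iff)

lemma sat_Neq:
  "sat K \<sigma> (a \<^bold>\<noteq> b) \<longleftrightarrow>
    (\<exists>m n. ev K (psub 0 \<sigma> a) (Val m) \<and> ev K (psub 0 \<sigma> b) (Val n) \<and> m \<noteq> n)"
  by (fastforce simp: sat_def)

text \<open>The semantic content of the rule that replaces equals by equals. Induction uses
  it too, to pass from numerals to arbitrary terms that denote numbers.\<close>

lemma sat_upd_cong:
  assumes "closing \<sigma>" and "closed_term a" and "closed_term b"
    and "ev K a (Val n)" and "ev K b (Val n)" and "sat K (\<sigma>(i := a)) p"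
  shows "sat K (\<sigma>(i := b)) p"
proof -
  have "interch K (psub 0 (\<sigma>(i := a)) p) (psub 0 (\<sigma>(i := b)) p)"
    by (rule interch_psub) (auto intro: interch.same_value[OF assms(2-5)])
  then show ?thesis using assms(6) ev_Val_interch by (auto simp: sat_def)
qed

lemma ev_arg_cong:
  assumes "closed_term a" and "closed_term b" and "ev K a (Val n)" and "ev K b (Val n)"
    and "ev K (f \<^bold>\<cdot> a) (Val m)"
  shows "ev K (f \<^bold>\<cdot> b) (Val m)"
  using ev_Val_interch[OF assms(5)] interch_App[OF interch_refl interch.same_value[OF assms(1-4)]]
  by blast

text \<open>Most rules merely restate how evaluation treats the connectives. Replacing equals by equals
  is the congruence property \<open>ev_interch\<close>. The same property serves induction, the recursor rule
  and the instances of quantifiers: these speak about arbitrary terms that denote a number, while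
  the models know about numerals.\<close>

lemma follows_sound:
  assumes "follows J j"
  shows "\<exists>K0. \<forall>K\<ge>K0. (\<forall>j\<in>J. valid K j) \<longrightarrow> valid K j"
proof -
  have nonconv: ?thesis if "\<And>K. \<forall>j\<in>J. valid K j \<Longrightarrow> valid K j"
    using that by blast
  from assms show ?thesis
  proof cases
    case (substitution \<Gamma> c s v)
    show ?thesis
    proof (rule nonconv)
      fix K assume "\<forall>j\<in>J. valid K j"
      then have IH: "valid K (\<Gamma> \<turnstile> c)" using substitution by blast
      have "sat K \<sigma> (subst v s c)"
        if \<sigma>: "closing \<sigma>" "\<forall>x. x |\<in>| subst v s |`| \<Gamma> \<longrightarrow> sat K \<sigma> x" for \<sigma>
      proof -
        have "sat K (\<sigma>(v := psub 0 \<sigma> s)) x" if "x |\<in>| \<Gamma>" for x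
          using \<sigma>(2) that sat_subst[OF \<sigma>(1)] by blast
        moreover have "closing (\<sigma>(v := psub 0 \<sigma> s))"
          using \<sigma>(1) closed_psub[OF \<sigma>(1)] by (rule closing_upd)
        ultimately show ?thesis using IH sat_subst[OF \<sigma>(1)] by simp
      qed
      then show "valid K j" using substitution by simp
    qed
  next
    case (contradiction \<Gamma> a c)
    show ?thesis
    proof (rule nonconv)
      fix K assume "\<forall>j\<in>J. valid K j"
      then have "valid K (\<Gamma> \<turnstile> \<^bold>\<not> a)" "valid K (\<Gamma> \<turnstile> a)" using contradiction by blast+
      then show "valid K j"
        using contradiction by (fastforce simp: sat_def dest: ev_deterministic)
    qed
  next
    case (eq_subst \<Gamma> a b v p)
    show ?thesis
    proof (rule nonconv)
      fix K assume "\<forall>j\<in>J. valid K j"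
      then have IH: "valid K (\<Gamma> \<turnstile> a \<^bold>= b)" "valid K (\<Gamma> \<turnstile> subst v a p)" using eq_subst by blast+
      have "sat K \<sigma> (subst v b p)" if \<sigma>: "closing \<sigma>" "\<forall>x. x |\<in>| \<Gamma> \<longrightarrow> sat K \<sigma> x" for \<sigma>
      proof -
        obtain n where "ev K (psub 0 \<sigma> a) (Val n)" "ev K (psub 0 \<sigma> b) (Val n)"
          using IH(1) \<sigma> by (auto simp: sat_Eq)
        moreover have "sat K (\<sigma>(v := psub 0 \<sigma> a)) p" using IH(2) \<sigma> by (simp add: sat_subst)
        ultimately show ?thesis
          using sat_upd_cong closed_psub \<sigma>(1) by (simp add: sat_subst) blast
      qed
      then show "valid K j" using eq_subst by simp
    qed
  next
    case (induction \<Gamma> i c a)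
    show ?thesis
    proof (rule nonconv)
      fix K assume "\<forall>j\<in>J. valid K j"
      then have base: "valid K (\<Gamma> \<turnstile> subst i Zero c)"
        and step: "valid K (finsert (isN (Var i)) (finsert c \<Gamma>) \<turnstile> subst i (Succ (Var i)) c)"
        and num: "valid K (\<Gamma> \<turnstile> isN a)" using induction by blast+
      have "sat K \<sigma> (subst i a c)" if \<sigma>: "closing \<sigma>" "\<forall>x. x |\<in>| \<Gamma> \<longrightarrow> sat K \<sigma> x" for \<sigma>
      proof -
        obtain n where n: "ev K (psub 0 \<sigma> a) (Val n)" using num \<sigma> by (auto simp: sat_isN)
        have "sat K (\<sigma>(i := num k)) c" for k
        proof (induction k)
          case 0
          then show ?case using base \<sigma> by (simp add: sat_subst del: fun_upd_apply)
        next
          case (Suc k)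
          let ?\<tau> = "\<sigma>(i := num k)"
          have cl: "closing ?\<tau>" using \<sigma>(1) closed_num by (rule closing_upd)
          have "sat K ?\<tau> x" if "x |\<in>| \<Gamma>" for x
            using that \<sigma>(2) induction(6)[OF that] psub_upd_fresh[of i 0 x \<sigma> "num k"]
            by (simp add: sat_def)
          moreover have "sat K ?\<tau> (isN (Var i))" using ev_num by (auto simp: sat_isN)
          ultimately have "sat K ?\<tau> (subst i (Succ (Var i)) c)" using step Suc cl
            by (auto simp del: fun_upd_apply)
          then show ?case using cl by (simp add: sat_subst fun_upd_same del: fun_upd_apply)
        qed
        then have "sat K (\<sigma>(i := psub 0 \<sigma> a)) c"
          using sat_upd_cong[OF \<sigma>(1) closed_num closed_psub[OF \<sigma>(1)] ev_num n] by blast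
        then show ?thesis using \<sigma>(1) by (simp add: sat_subst)
      qed
      then show "valid K j" using induction by simp
    qed
  next
    case (conv_back c c' \<Gamma>)
    then obtain K0 where "\<forall>K\<ge>K0. conv_ok K c c'" using head_step_conv_ok by blast
    then show ?thesis using conv_back by (fastforce simp: conv_ok_def sat_def)
  next
    case (conv_fwd c c' \<Gamma>)
    then obtain K0 where "\<forall>K\<ge>K0. conv_ok K c c'" using head_step_conv_ok by blast
    then show ?thesis using conv_fwd by (fastforce simp: conv_ok_def sat_def)
  next
    case (conv_eq c c' \<Gamma>)
    then obtain K0 where "\<forall>K\<ge>K0. conv_ok K c c'" using head_step_conv_ok by blast
    moreover have "valid K j" if "conv_ok K c c'" "\<forall>j\<in>J. valid K j" for K
    proof -
      have "valid K (\<Gamma> \<turnstile> isN c')" using that conv_eq by blast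
      then show ?thesis using that(1) conv_eq(1) unfolding conv_ok_def
        by (fastforce simp: sat_isN sat_Eq)
    qed
    ultimately show ?thesis by blast
  next
    case (recursor \<Gamma> m h g)
    show ?thesis
    proof (rule nonconv)
      fix K assume "\<forall>j\<in>J. valid K j"
      then have IH: "valid K (\<Gamma> \<turnstile> isN m)" "valid K (\<Gamma> \<turnstile> isN (h \<^bold>\<cdot> m \<^bold>\<cdot> (Rec \<^bold>\<cdot> g \<^bold>\<cdot> h \<^bold>\<cdot> m)))"
        using recursor by blast+
      have "sat K \<sigma> (Rec \<^bold>\<cdot> g \<^bold>\<cdot> h \<^bold>\<cdot> Succ m \<^bold>= h \<^bold>\<cdot> m \<^bold>\<cdot> (Rec \<^bold>\<cdot> g \<^bold>\<cdot> h \<^bold>\<cdot> m))"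
        if \<sigma>: "closing \<sigma>" "\<forall>x. x |\<in>| \<Gamma> \<longrightarrow> sat K \<sigma> x" for \<sigma>
      proof -
        let ?m = "psub 0 \<sigma> m" and ?g = "psub 0 \<sigma> g" and ?h = "psub 0 \<sigma> h"
        have "sat K \<sigma> (isN m)" using IH(1) \<sigma> by simp
        then obtain n where n: "ev K ?m (Val n)" by (auto simp: sat_isN)
        have "sat K \<sigma> (isN (h \<^bold>\<cdot> m \<^bold>\<cdot> (Rec \<^bold>\<cdot> g \<^bold>\<cdot> h \<^bold>\<cdot> m)))" using IH(2) \<sigma> by simp
        then obtain r where r: "ev K (?h \<^bold>\<cdot> ?m \<^bold>\<cdot> (Rec \<^bold>\<cdot> ?g \<^bold>\<cdot> ?h \<^bold>\<cdot> ?m)) (Val r)"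
          by (auto simp: sat_isN)
        have "interch K ?m (num n)"
          using interch.same_value[OF closed_psub[OF \<sigma>(1)] closed_num n ev_num] .
        then have "interch K (?h \<^bold>\<cdot> ?m \<^bold>\<cdot> (Rec \<^bold>\<cdot> ?g \<^bold>\<cdot> ?h \<^bold>\<cdot> ?m))
            (?h \<^bold>\<cdot> num n \<^bold>\<cdot> (Rec \<^bold>\<cdot> ?g \<^bold>\<cdot> ?h \<^bold>\<cdot> num n))"
          by (intro interch_App interch_refl)
        then have "ev K (Rec \<^bold>\<cdot> ?g \<^bold>\<cdot> ?h \<^bold>\<cdot> Succ ?m) (Val r)"
          using ev_Val_interch[OF r] by (simp add: ev_Rec_Succ[OF n])
        then show ?thesis using r by (auto simp: sat_Eq)
      qed
      then show "valid K j" using recursor by simp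
    qed
  next
    case (all_I \<Gamma> f)
    show ?thesis
    proof (rule nonconv)
      fix K assume "\<forall>j\<in>J. valid K j"
      then have IH: "valid K (finsert (isN (Var 0)) (lift |`| \<Gamma>) \<turnstile> lift f \<^bold>\<cdot> Var 0)"
        using all_I by blast
      have "sat K \<sigma> (AllC \<^bold>\<cdot> f)" if \<sigma>: "closing \<sigma>" "\<forall>x. x |\<in>| \<Gamma> \<longrightarrow> sat K \<sigma> x" for \<sigma>
      proof -
        have "ev K (psub 0 \<sigma> f \<^bold>\<cdot> num n) (Val tt)" for n
        proof -
          let ?\<tau> = "case_nat (num n) \<sigma>"
          have "sat K ?\<tau> (isN (Var 0))" using ev_num by (auto simp: sat_isN)
          moreover have "sat K ?\<tau> (lift x) \<longleftrightarrow> sat K \<sigma> x" for x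
            by (simp add: sat_def psub_lift_at)
          ultimately have "sat K ?\<tau> x" if "x |\<in>| finsert (isN (Var 0)) (lift |`| \<Gamma>)" for x
            using that \<sigma>(2) by auto
          moreover have "closing ?\<tau>" using \<sigma>(1) closed_num by (rule closing_case_nat)
          ultimately have "sat K ?\<tau> (lift f \<^bold>\<cdot> Var 0)" using IH unfolding valid.simps by blast
          then show ?thesis by (simp add: sat_def psub_lift_at)
        qed
        then show ?thesis by (simp add: sat_def ev.App_All_tt ev.All)
      qed
      then show "valid K j" using all_I by simp
    qed
  next
    case (all_E \<Gamma> f a)
    show ?thesis
    proof (rule nonconv)
      fix K assume "\<forall>j\<in>J. valid K j"
      then have IH: "valid K (\<Gamma> \<turnstile> AllC \<^bold>\<cdot> f)" "valid K (\<Gamma> \<turnstile> isN a)" using all_E by blast+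
      have "sat K \<sigma> (f \<^bold>\<cdot> a)" if \<sigma>: "closing \<sigma>" "\<forall>x. x |\<in>| \<Gamma> \<longrightarrow> sat K \<sigma> x" for \<sigma>
      proof -
        have "sat K \<sigma> (isN a)" using IH(2) \<sigma> by simp
        then obtain n where n: "ev K (psub 0 \<sigma> a) (Val n)" by (auto simp: sat_isN)
        have "ev K (AllC \<^bold>\<cdot> psub 0 \<sigma> f) (Val tt)" using IH(1) \<sigma> by (simp add: sat_def)
        then have "ev K (psub 0 \<sigma> f \<^bold>\<cdot> num n) (Val tt)" by (simp add: ev_All_App)
        then show ?thesis
          using ev_arg_cong[OF closed_num closed_psub[OF \<sigma>(1)] ev_num n] by (simp add: sat_def)
      qed
      then show "valid K j" using all_E by simp
    qed
  next
    case (not_all_I \<Gamma> f a)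
    show ?thesis
    proof (rule nonconv)
      fix K assume "\<forall>j\<in>J. valid K j"
      then have IH: "valid K (\<Gamma> \<turnstile> \<^bold>\<not> (f \<^bold>\<cdot> a))" "valid K (\<Gamma> \<turnstile> isN a)" using not_all_I by blast+
      have "sat K \<sigma> (\<^bold>\<not> (AllC \<^bold>\<cdot> f))" if \<sigma>: "closing \<sigma>" "\<forall>x. x |\<in>| \<Gamma> \<longrightarrow> sat K \<sigma> x" for \<sigma>
      proof -
        have "sat K \<sigma> (isN a)" using IH(2) \<sigma> by simp
        then obtain n where n: "ev K (psub 0 \<sigma> a) (Val n)" by (auto simp: sat_isN)
        have "ev K (psub 0 \<sigma> f \<^bold>\<cdot> psub 0 \<sigma> a) (Val ff)" using IH(1) \<sigma> by (simp add: sat_def)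
        then have "ev K (psub 0 \<sigma> f \<^bold>\<cdot> num n) (Val ff)"
          using ev_arg_cong[OF closed_psub[OF \<sigma>(1)] closed_num n ev_num] by blast
        then show ?thesis by (auto simp: sat_def ev_All_App)
      qed
      then show "valid K j" using not_all_I by simp
    qed
  next
    case (not_all_E \<Gamma> f c)
    show ?thesis
    proof (rule nonconv)
      fix K assume "\<forall>j\<in>J. valid K j"
      then have IH: "valid K (\<Gamma> \<turnstile> \<^bold>\<not> (AllC \<^bold>\<cdot> f))"
        "valid K (finsert (isN (Var 0)) (finsert (\<^bold>\<not> (lift f \<^bold>\<cdot> Var 0)) (lift |`| \<Gamma>)) \<turnstile> lift c)"
        using not_all_E by blast+
      have "sat K \<sigma> c" if \<sigma>: "closing \<sigma>" "\<forall>x. x |\<in>| \<Gamma> \<longrightarrow> sat K \<sigma> x" for \<sigma>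
      proof -
        have "sat K \<sigma> (\<^bold>\<not> (AllC \<^bold>\<cdot> f))" using IH(1) \<sigma> by simp
        then obtain n where n: "ev K (psub 0 \<sigma> f \<^bold>\<cdot> num n) (Val ff)"
          by (auto simp: sat_def ev_All_App)
        let ?\<tau> = "case_nat (num n) \<sigma>"
        have "sat K ?\<tau> (isN (Var 0))" using ev_num by (auto simp: sat_isN)
        moreover have "sat K ?\<tau> (\<^bold>\<not> (lift f \<^bold>\<cdot> Var 0))" using n by (simp add: sat_def psub_lift_at)
        moreover have lift: "sat K ?\<tau> (lift x) \<longleftrightarrow> sat K \<sigma> x" for x
          by (simp add: sat_def psub_lift_at)
        ultimately have "sat K ?\<tau> x"
          if "x |\<in>| finsert (isN (Var 0)) (finsert (\<^bold>\<not> (lift f \<^bold>\<cdot> Var 0)) (lift |`| \<Gamma>))" for x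
          using that \<sigma>(2) by auto
        moreover have "closing ?\<tau>" using \<sigma>(1) closed_num by (rule closing_case_nat)
        ultimately have "sat K ?\<tau> (lift c)" using IH(2) unfolding valid.simps by blast
        then show ?thesis by (simp only: lift)
      qed
      then show "valid K j" using not_all_E by simp
    qed
  next
    case (hyp c \<Gamma>)
    have "valid K (finsert c \<Gamma> \<turnstile> c)" for K
      by (auto simp: sat_connectives sat_Eq sat_Neq)
    then show ?thesis using hyp by (intro nonconv) blast
  next
    case (weaken \<Gamma> c a)
    have "valid K (finsert a \<Gamma> \<turnstile> c)"
      if "valid K (\<Gamma> \<turnstile> c)" for K
      using that by (auto simp: sat_connectives sat_Eq sat_Neq)
    then show ?thesis using weaken by (intro nonconv) blast
  next
    case (cut \<Gamma> a c)
    have "valid K (\<Gamma> \<turnstile> c)"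
      if "valid K (\<Gamma> \<turnstile> a)" "valid K (finsert a \<Gamma> \<turnstile> c)" for K
      using that by (auto simp: sat_connectives sat_Eq sat_Neq)
    then show ?thesis using cut by (intro nonconv) blast
  next
    case (true_I \<Gamma> a)
    have "valid K (\<Gamma> \<turnstile> a \<^bold>= num 1)"
      if "valid K (\<Gamma> \<turnstile> a)" for K
      using that by (auto simp: sat_connectives)
    then show ?thesis using true_I by (intro nonconv) blast
  next
    case (true_E \<Gamma> a)
    have "valid K (\<Gamma> \<turnstile> a)"
      if "valid K (\<Gamma> \<turnstile> a \<^bold>= num 1)" for K
      using that by (auto simp: sat_connectives)
    then show ?thesis using true_E by (intro nonconv) blast
  next
    case (false_I \<Gamma> a)
    have "valid K (\<Gamma> \<turnstile> a \<^bold>= num 0)"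
      if "valid K (\<Gamma> \<turnstile> \<^bold>\<not> a)" for K
      using that by (auto simp: sat_connectives)
    then show ?thesis using false_I by (intro nonconv) blast
  next
    case (false_E \<Gamma> a)
    have "valid K (\<Gamma> \<turnstile> \<^bold>\<not> a)"
      if "valid K (\<Gamma> \<turnstile> a \<^bold>= num 0)" for K
      using that by (auto simp: sat_connectives)
    then show ?thesis using false_E by (intro nonconv) blast
  next
    case (not_not_I \<Gamma> a)
    have "valid K (\<Gamma> \<turnstile> \<^bold>\<not> \<^bold>\<not> a)"
      if "valid K (\<Gamma> \<turnstile> a)" for K
      using that by (auto simp: sat_connectives sat_Eq sat_Neq)
    then show ?thesis using not_not_I by (intro nonconv) blast
  next
    case (not_not_E \<Gamma> a)
    have "valid K (\<Gamma> \<turnstile> a)"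
      if "valid K (\<Gamma> \<turnstile> \<^bold>\<not> \<^bold>\<not> a)" for K
      using that by (auto simp: sat_connectives sat_Eq sat_Neq)
    then show ?thesis using not_not_E by (intro nonconv) blast
  next
    case (or_I1 \<Gamma> a b)
    have "valid K (\<Gamma> \<turnstile> a \<^bold>\<or> b)"
      if "valid K (\<Gamma> \<turnstile> a)" for K
      using that by (auto simp: sat_connectives sat_Eq sat_Neq)
    then show ?thesis using or_I1 by (intro nonconv) blast
  next
    case (or_I2 \<Gamma> b a)
    have "valid K (\<Gamma> \<turnstile> a \<^bold>\<or> b)"
      if "valid K (\<Gamma> \<turnstile> b)" for K
      using that by (auto simp: sat_connectives sat_Eq sat_Neq)
    then show ?thesis using or_I2 by (intro nonconv) blast
  next
    case (not_or_I \<Gamma> a b)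
    have "valid K (\<Gamma> \<turnstile> \<^bold>\<not> (a \<^bold>\<or> b))"
      if "valid K (\<Gamma> \<turnstile> \<^bold>\<not> a)" "valid K (\<Gamma> \<turnstile> \<^bold>\<not> b)" for K
      using that by (auto simp: sat_connectives sat_Eq sat_Neq)
    then show ?thesis using not_or_I by (intro nonconv) blast
  next
    case (or_E \<Gamma> a b c)
    have "valid K (\<Gamma> \<turnstile> c)"
      if "valid K (\<Gamma> \<turnstile> a \<^bold>\<or> b)" "valid K (finsert a \<Gamma> \<turnstile> c)" "valid K (finsert b \<Gamma> \<turnstile> c)" for K
      using that by (auto simp: sat_connectives sat_Eq sat_Neq)
    then show ?thesis using or_E by (intro nonconv) blast
  next
    case (not_or_E1 \<Gamma> a b)
    have "valid K (\<Gamma> \<turnstile> \<^bold>\<not> a)"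
      if "valid K (\<Gamma> \<turnstile> \<^bold>\<not> (a \<^bold>\<or> b))" for K
      using that by (auto simp: sat_connectives sat_Eq sat_Neq)
    then show ?thesis using not_or_E1 by (intro nonconv) blast
  next
    case (not_or_E2 \<Gamma> a b)
    have "valid K (\<Gamma> \<turnstile> \<^bold>\<not> b)"
      if "valid K (\<Gamma> \<turnstile> \<^bold>\<not> (a \<^bold>\<or> b))" for K
      using that by (auto simp: sat_connectives sat_Eq sat_Neq)
    then show ?thesis using not_or_E2 by (intro nonconv) blast
  next
    case (isN_E \<Gamma> a)
    have "valid K (\<Gamma> \<turnstile> a \<^bold>= a)"
      if "valid K (\<Gamma> \<turnstile> isN a)" for K
      using that by (auto simp: sat_connectives sat_Eq sat_Neq)
    then show ?thesis using isN_E by (intro nonconv) blast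
  next
    case (isN_I \<Gamma> a)
    have "valid K (\<Gamma> \<turnstile> isN a)"
      if "valid K (\<Gamma> \<turnstile> a \<^bold>= a)" for K
      using that by (auto simp: sat_connectives sat_Eq sat_Neq)
    then show ?thesis using isN_I by (intro nonconv) blast
  next
    case (eq_sym \<Gamma> a b)
    have "valid K (\<Gamma> \<turnstile> b \<^bold>= a)"
      if "valid K (\<Gamma> \<turnstile> a \<^bold>= b)" for K
      using that by (auto simp: sat_connectives sat_Eq sat_Neq)
    then show ?thesis using eq_sym by (intro nonconv) blast
  next
    case (neq_sym \<Gamma> a b)
    have "valid K (\<Gamma> \<turnstile> b \<^bold>\<noteq> a)"
      if "valid K (\<Gamma> \<turnstile> a \<^bold>\<noteq> b)" for K
      using that by (simp add: sat_connectives sat_Eq sat_Neq) (metis nat.inject)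
    then show ?thesis using neq_sym by (intro nonconv) blast
  next
    case (eq_B_I \<Gamma> a b)
    have "valid K (\<Gamma> \<turnstile> isB (a \<^bold>= b))"
      if "valid K (\<Gamma> \<turnstile> isN a)" "valid K (\<Gamma> \<turnstile> isN b)" for K
      using that by (simp add: sat_connectives sat_Eq sat_Neq) (metis nat.inject)
    then show ?thesis using eq_B_I by (intro nonconv) blast
  next
    case (eq_B_E \<Gamma> a b)
    have "valid K (\<Gamma> \<turnstile> isN a \<^bold>\<and> isN b)"
      if "valid K (\<Gamma> \<turnstile> isB (a \<^bold>= b))" for K
      using that by (auto simp: sat_connectives sat_Eq sat_Neq)
    then show ?thesis using eq_B_E by (intro nonconv) blast
  next
    case (zero_N \<Gamma>)
    have "valid K (\<Gamma> \<turnstile> isN Zero)" for K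
      by (auto simp: sat_connectives sat_Eq sat_Neq)
    then show ?thesis using zero_N by (intro nonconv) blast
  next
    case (Succ_N_I \<Gamma> a)
    have "valid K (\<Gamma> \<turnstile> isN (Succ a))"
      if "valid K (\<Gamma> \<turnstile> isN a)" for K
      using that by (auto simp: sat_connectives sat_Eq sat_Neq)
    then show ?thesis using Succ_N_I by (intro nonconv) blast
  next
    case (Succ_N_E \<Gamma> a)
    have "valid K (\<Gamma> \<turnstile> isN a)"
      if "valid K (\<Gamma> \<turnstile> isN (Succ a))" for K
      using that by (auto simp: sat_connectives sat_Eq sat_Neq)
    then show ?thesis using Succ_N_E by (intro nonconv) blast
  next
    case (Succ_neq_0 \<Gamma> a)
    have "valid K (\<Gamma> \<turnstile> Succ a \<^bold>\<noteq> Zero)"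
      if "valid K (\<Gamma> \<turnstile> isN a)" for K
      using that by (simp add: sat_Eq sat_Neq) (metis zero_less_Suc)
    then show ?thesis using Succ_neq_0 by (intro nonconv) blast
  next
    case (Succ_neq_I \<Gamma> a b)
    have "valid K (\<Gamma> \<turnstile> Succ a \<^bold>\<noteq> Succ b)"
      if "valid K (\<Gamma> \<turnstile> a \<^bold>\<noteq> b)" for K
      using that by (simp add: sat_connectives sat_Eq sat_Neq) (metis nat.inject)
    then show ?thesis using Succ_neq_I by (intro nonconv) blast
  next
    case (Succ_neq_E \<Gamma> a b)
    have "valid K (\<Gamma> \<turnstile> a \<^bold>\<noteq> b)"
      if "valid K (\<Gamma> \<turnstile> Succ a \<^bold>\<noteq> Succ b)" for K
      using that by (auto simp: sat_connectives sat_Eq sat_Neq)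
    then show ?thesis using Succ_neq_E by (intro nonconv) blast
  next
    case (Succ_eq_E \<Gamma> a b)
    have "valid K (\<Gamma> \<turnstile> a \<^bold>= b)"
      if "valid K (\<Gamma> \<turnstile> Succ a \<^bold>= Succ b)" for K
      using that by (auto simp: sat_connectives sat_Eq sat_Neq)
    then show ?thesis using Succ_eq_E by (intro nonconv) blast
  next
    case (Bot_N_E \<Gamma> p)
    have "valid K (\<Gamma> \<turnstile> p)"
      if "valid K (\<Gamma> \<turnstile> isN Bot)" for K
      using that by (auto simp: sat_connectives sat_Eq sat_Neq)
    then show ?thesis using Bot_N_E by (intro nonconv) blast
  qed
qed


text \<open>The bounds of the finitely many steps have a common maximum.\<close>

lemma proof_sound:
  assumes "valid_proof P"
  shows "\<exists>K. \<forall>j\<in>set P. valid K j"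
proof -
  have "\<exists>K0. \<forall>K\<ge>K0. \<forall>j\<in>set (take i P). valid K j" if "i \<le> length P" for i
    using that
  proof (induction i)
    case (Suc i)
    then obtain K0 where K0: "\<forall>K\<ge>K0. \<forall>j\<in>set (take i P). valid K j" by auto
    have "follows (set (take i P)) (P ! i)" using assms Suc by (simp add: valid_proof_def)
    from follows_sound[OF this] obtain K1 where
      K1: "\<forall>K\<ge>K1. (\<forall>j\<in>set (take i P). valid K j) \<longrightarrow> valid K (P ! i)" by blast
    have "\<forall>K\<ge>max K0 K1. \<forall>j\<in>set (take (Suc i) P). valid K j"
      using K0 K1 Suc.prems by (auto simp: take_Suc_conv_app_nth)
    then show ?case by blast
  qed simp
  from this[of "length P"] show ?thesis by auto
qed


section \<open>Building derivations\<close>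

lemma valid_proof_append: "valid_proof P \<Longrightarrow> follows (set P) j \<Longrightarrow> valid_proof (P @ [j])"
  by (auto simp: valid_proof_def nth_append less_Suc_eq)

lemma derivable_axiom: "follows {} j \<Longrightarrow> derivable j"
  unfolding derivable_def proves_def
  by (intro exI[of _ "[j]"]) (simp add: valid_proof_def)

lemma derivable_step:
  assumes "derivable j" and "\<And>J. j \<in> J \<Longrightarrow> follows J j'"
  shows "derivable j'"
proof -
  obtain P where "valid_proof P" "j \<in> set P" using assms(1) by (auto simp: derivable_def proves_def)
  then have "valid_proof (P @ [j'])" using assms(2) valid_proof_append by blast
  then show ?thesis unfolding derivable_def proves_def by (intro exI[of _ "P @ [j']"]) simp
qed

lemma derivable_conv_back: "c \<triangleright> c' \<Longrightarrow> derivable (\<Gamma> \<turnstile> c') \<Longrightarrow> derivable (\<Gamma> \<turnstile> c)"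
  by (erule derivable_step) (rule follows.conv_back)

text \<open>The numeral one is a true formula, because it equals one.\<close>

lemma derivable_one: "derivable ({||} \<turnstile> num 1)"
proof -
  have "derivable ({||} \<turnstile> isN Zero)" by (rule derivable_axiom) (rule follows.zero_N)
  then have "derivable ({||} \<turnstile> isN (Succ Zero))" by (rule derivable_step) (rule follows.Succ_N_I)
  then have "derivable ({||} \<turnstile> num 1 \<^bold>= num 1)" by (simp add: One_nat_def)
  then show ?thesis by (rule derivable_step) (rule follows.true_E)
qed


section \<open>A recursion through functions\<close>

text \<open>Base case and step of the recursion. The step is \<open>\<lambda>m. \<lambda>f. f\<close>, so every stage is extensionally
  the constant function with value one.\<close>

abbreviation const_one :: rterm where "const_one \<equiv> Lam (num 1)"
abbreviation pass_on :: rterm where "pass_on \<equiv> Lam (Lam (Var 0))"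

definition fun_rec :: "rterm \<Rightarrow> rterm" where
  "fun_rec t = Rec \<^bold>\<cdot> const_one \<^bold>\<cdot> pass_on \<^bold>\<cdot> t"

definition witness :: rterm where
  "witness = Lam (fun_rec (Var 0) \<^bold>\<cdot> Zero)"

lemma wf_num: "wf_term (num n)"
  by (induction n) (auto intro: wf_term.intros)

lemma wf_fun_rec: "wf_term t \<Longrightarrow> wf_term (fun_rec t)"
  unfolding fun_rec_def by (intro wf_term.intros wf_num)

lemma wf_witness: "wf_term witness"
  unfolding witness_def by (intro wf_term.intros wf_fun_rec)

lemma closed_witness: "closed_term witness"
  by (simp add: closed_term_def witness_def fun_rec_def One_nat_def)

lemma inst_witness_body: "inst (fun_rec (Var 0) \<^bold>\<cdot> Zero) t = fun_rec t \<^bold>\<cdot> Zero"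
  by (simp add: fun_rec_def One_nat_def)

lemma derivable_fun_rec: "derivable ({||} \<turnstile> fun_rec (num n) \<^bold>\<cdot> Zero)"
proof (induction n)
  case 0
  have "const_one \<^bold>\<cdot> Zero \<triangleright> num 1"
    using head_step.beta[OF wf_term.intros(3), of "num 1"] by (simp add: One_nat_def)
  then have "derivable ({||} \<turnstile> const_one \<^bold>\<cdot> Zero)"
    using derivable_one by (rule derivable_conv_back)
  moreover have "fun_rec (num 0) \<^bold>\<cdot> Zero \<triangleright> const_one \<^bold>\<cdot> Zero"
    unfolding fun_rec_def num.simps
    by (intro head_step.app head_step.rec_0 wf_term.intros)
  ultimately show ?case by (rule derivable_conv_back[rotated])
next
  case (Suc n)
  have "Lam (Var 0) \<^bold>\<cdot> fun_rec (num n) \<^bold>\<cdot> Zero \<triangleright> fun_rec (num n) \<^bold>\<cdot> Zero"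
    using head_step.app[OF head_step.beta[OF wf_fun_rec[OF wf_num], of "Var 0" n]] by simp
  then have *: "derivable ({||} \<turnstile> Lam (Var 0) \<^bold>\<cdot> fun_rec (num n) \<^bold>\<cdot> Zero)"
    using Suc by (rule derivable_conv_back)
  have "pass_on \<^bold>\<cdot> num n \<^bold>\<cdot> fun_rec (num n) \<^bold>\<cdot> Zero \<triangleright> Lam (Var 0) \<^bold>\<cdot> fun_rec (num n) \<^bold>\<cdot> Zero"
    using head_step.app[OF head_step.app[OF head_step.beta[OF wf_num, of "Lam (Var 0)" n]]]
    by simp
  then have "derivable ({||} \<turnstile> pass_on \<^bold>\<cdot> num n \<^bold>\<cdot> fun_rec (num n) \<^bold>\<cdot> Zero)"
    using * by (rule derivable_conv_back)
  moreover have "fun_rec (num (Suc n)) \<^bold>\<cdot> Zero \<triangleright> pass_on \<^bold>\<cdot> num n \<^bold>\<cdot> fun_rec (num n) \<^bold>\<cdot> Zero"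
    unfolding fun_rec_def num.simps
    by (intro head_step.app head_step.rec_Suc wf_term.intros wf_num)
  ultimately show ?case by (rule derivable_conv_back[rotated])
qed

lemma derivable_witness: "derivable ({||} \<turnstile> witness \<^bold>\<cdot> num n)"
proof (rule derivable_conv_back)
  show "witness \<^bold>\<cdot> num n \<triangleright> fun_rec (num n) \<^bold>\<cdot> Zero"
    using head_step.beta[OF wf_num, of "fun_rec (Var 0) \<^bold>\<cdot> Zero" n]
    by (simp only: witness_def inst_witness_body)
qed (rule derivable_fun_rec)

text \<open>At \<open>Suc K\<close> the recursion may only return a number, and a number cannot be applied.\<close>

lemma not_ev_witness: "\<not> ev K (witness \<^bold>\<cdot> num (Suc K)) w"
proof
  assume "ev K (witness \<^bold>\<cdot> num (Suc K)) w"
  then have "ev K (fun_rec (num (Suc K)) \<^bold>\<cdot> Zero) w"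
    unfolding witness_def ev_beta inst_witness_body .
  moreover have "ev K (fun_rec (num (Suc K))) v \<Longrightarrow> \<exists>n. v = Val n" for v
    by (simp add: fun_rec_def ev_Rec_Succ[OF ev_num])
  ultimately show False
    using ev_App[THEN iffD1, of K "fun_rec (num (Suc K))" Zero w] by blast
qed

text \<open>A proof would be sound for some \<open>K\<close>, and interpreting the variable by \<open>Suc K\<close> refutes
  its conclusion there.\<close>

lemma not_derivable_uniformly:
  "\<not> derivable ({|isN (Var 0)|} \<turnstile> lift witness \<^bold>\<cdot> Var 0)"
proof
  assume "derivable ({|isN (Var 0)|} \<turnstile> lift witness \<^bold>\<cdot> Var 0)"
  then obtain K where K: "valid K ({|isN (Var 0)|} \<turnstile> lift witness \<^bold>\<cdot> Var 0)"
    unfolding derivable_def proves_def using proof_sound by blast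
  (* The first recursion argument at which a function is no longer returned. *)
  let ?\<sigma> = "\<lambda>_::nat. num (Suc K)"
  have "closing ?\<sigma>" unfolding closing_def by (intro allI closed_num)
  moreover have "sat K ?\<sigma> (isN (Var 0))"
    using ev_num[of K "Suc K"] by (auto simp: sat_isN)
  ultimately have "sat K ?\<sigma> (lift witness \<^bold>\<cdot> Var 0)" using K by simp
  moreover have "psub 0 ?\<sigma> (lift witness \<^bold>\<cdot> Var 0) = witness \<^bold>\<cdot> num (Suc K)"
    by (simp add: witness_def fun_rec_def One_nat_def)
  ultimately show False using not_ev_witness by (simp add: sat_def)
qed

text \<open>The only head shape of \<open>AllC\<close> is \<open>HAll\<close>, so evaluation to true must be justified by a proof
  of the uniform sequent.\<close>

lemma eval_All_derivable:
  assumes "eval s (AllC \<^bold>\<cdot> u) tt"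
  shows "derivable ({|isN (Var 0)|} \<turnstile> lift u \<^bold>\<cdot> Var 0)"
proof -
  have head: "w = HAll" if "hd_eval s AllC w" for s w
    using that by (rule hd_eval.cases) auto
  show ?thesis
    using assms by (rule eval.cases) (auto simp: derivable_def dest: head)
qed

theorem corollary6p1:
  "\<exists>u. closed_term u \<and> wf_term u \<and>
       (\<forall>n. derivable ({||} \<turnstile> u \<^bold>\<cdot> num n)) \<and>
       \<not> (\<exists>s. eval s (AllC \<^bold>\<cdot> u) tt)"
proof (intro exI conjI allI notI)
  show "closed_term witness" "wf_term witness"
    by (rule closed_witness wf_witness)+
  show "derivable ({||} \<turnstile> witness \<^bold>\<cdot> num n)" for n
    by (rule derivable_witness)
  assume "\<exists>s. eval s (AllC \<^bold>\<cdot> witness) tt"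
  then show False
    using eval_All_derivable not_derivable_uniformly by blast
qed

end
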